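(* There exists an absolute constant $C>0$ such that, for every $n\ge1$, every log-concave probability measure $\mu$ on $\mathbb{R}^n$ and every $p\geq1$, $$\|\Lambda_\mu^*\|_{L^p(\mu)}\leq Cn(\log n+p).$$ Equivalently, after changing the absolute constant $C$, for every $n\ge 1$, every log-concave probability measure $\mu$ on $\mathbb{R}^n$ and every $u\geq 0$, $$\mu\left(\left\{x:\Lambda_\mu^*(x)>Cn(\log n+u)\right\}\right)\leq e^{-u}.$$
   Context: A Borel probability measure $\mu$ on $\mathbb{R}^n$ is log-concave if it is full-dimensional (i.e. $\mu(H)<1$ for every hyperplane $H$) and $\mu(\lambda A+(1-\lambda)B)\geq\mu(A)^\lambda\mu(B)^{1-\lambda}$ for all non-empty compact sets $A,B\subseteq\mathbb{R}^n$ and all $\lambda\in(0,1)$; equivalently it has a log-concave density with respect to Lebesgue measure. $\Lambda_\mu(\theta)=\log\int_{\mathbb{R}^n}e^{\langle\theta,x\rangle}\,d\mu(x)$ for $\theta\in\mathbb{R}^n$, and the Cramér transform is $\Lambda_\mu^*(x)=\sup_{\theta\in\mathbb{R}^n}\{\langle\theta,x\rangle-\Lambda_\mu(\theta)\}\in[0,\infty]$. $\|f\|_{L^p(\mu)}=(\int|f|^p\,d\mu)^{1/p}$. *)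

theory Defs
  imports "HOL-Probability.Probability"
begin

text \<open>
  The dimension \<open>n\<close> has to be quantified inside the statement (the constant must not depend
  on it), so \<open>\<real>\<^sup>n\<close> is not \<open>real ^ 'n\<close> but the set of functions \<open>nat \<Rightarrow> real\<close> that are
  \<open>undefined\<close> outside \<open>{..<n}\<close>, with the topology \<open>powertop_real {..<n}\<close> and the product
  Borel sigma-algebra (which is the Borel sigma-algebra of that topology, see
  \<open>sets_PiM_borel_eq_sigma_open\<close> below).
\<close>

abbreviation Rn :: "nat \<Rightarrow> (nat \<Rightarrow> real) set" where
  "Rn n \<equiv> {..<n} \<rightarrow>\<^sub>E UNIV"

definition dot :: "nat \<Rightarrow> (nat \<Rightarrow> real) \<Rightarrow> (nat \<Rightarrow> real) \<Rightarrow> real" where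
  "dot n x y = (\<Sum>i<n. x i * y i)"

definition compact_Rn :: "nat \<Rightarrow> (nat \<Rightarrow> real) set \<Rightarrow> bool" where
  "compact_Rn n A \<longleftrightarrow> compactin (powertop_real {..<n}) A"

definition hyperplane :: "nat \<Rightarrow> (nat \<Rightarrow> real) set \<Rightarrow> bool" where
  "hyperplane n H \<longleftrightarrow>
     (\<exists>a\<in>Rn n. \<exists>b. (\<exists>i<n. a i \<noteq> 0) \<and> H = {x \<in> Rn n. dot n a x = b})"

definition mink_comb ::
  "nat \<Rightarrow> real \<Rightarrow> (nat \<Rightarrow> real) set \<Rightarrow> (nat \<Rightarrow> real) set \<Rightarrow> (nat \<Rightarrow> real) set" where
  "mink_comb n l A B = {(\<lambda>i\<in>{..<n}. l * x i + (1 - l) * y i) | x y. x \<in> A \<and> y \<in> B}"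

definition borel_prob_Rn :: "nat \<Rightarrow> (nat \<Rightarrow> real) measure \<Rightarrow> bool" where
  "borel_prob_Rn n \<mu> \<longleftrightarrow>
     prob_space \<mu> \<and> sets \<mu> = sets (Pi\<^sub>M {..<n} (\<lambda>_. borel :: real measure))"

definition log_concave_prob :: "nat \<Rightarrow> (nat \<Rightarrow> real) measure \<Rightarrow> bool" where
  "log_concave_prob n \<mu> \<longleftrightarrow>
     borel_prob_Rn n \<mu> \<and>
     (\<forall>H. hyperplane n H \<longrightarrow> measure \<mu> H < 1) \<and>
     (\<forall>A B l. compact_Rn n A \<and> A \<noteq> {} \<and> compact_Rn n B \<and> B \<noteq> {} \<and> 0 < l \<and> l < 1 \<longrightarrow>
        measure \<mu> (mink_comb n l A B) \<ge> measure \<mu> A powr l * measure \<mu> B powr (1 - l))"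

text \<open>
  The integral is a strictly positive element of \<open>[0, \<infinity>]\<close> for every probability measure, so
  the logarithm takes values in \<open>(-\<infinity>, \<infinity>]\<close> and the differences in \<open>cramer\<close> are never of the
  form \<open>\<infinity> - \<infinity>\<close>.
\<close>

definition log_laplace :: "nat \<Rightarrow> (nat \<Rightarrow> real) measure \<Rightarrow> (nat \<Rightarrow> real) \<Rightarrow> ereal" where
  "log_laplace n \<mu> \<theta> =
     (let I = (\<integral>\<^sup>+ x. ennreal (exp (dot n \<theta> x)) \<partial>\<mu>)
      in if I = \<infinity> then \<infinity> else ereal (ln (enn2real I)))"

definition cramer :: "nat \<Rightarrow> (nat \<Rightarrow> real) measure \<Rightarrow> (nat \<Rightarrow> real) \<Rightarrow> ereal" where
  "cramer n \<mu> x = (SUP \<theta>\<in>Rn n. ereal (dot n \<theta> x) - log_laplace n \<mu> \<theta>)"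

text \<open>Real powers on \<open>[0, \<infinity>]\<close>, meant for exponents \<open>p > 0\<close>.\<close>

definition ennreal_rpow :: "ennreal \<Rightarrow> real \<Rightarrow> ennreal" where
  "ennreal_rpow x p = (if x = \<infinity> then \<infinity> else ennreal (enn2real x powr p))"

definition Lp_norm :: "real \<Rightarrow> 'a measure \<Rightarrow> ('a \<Rightarrow> ereal) \<Rightarrow> ennreal" where
  "Lp_norm p M f =
     ennreal_rpow (\<integral>\<^sup>+ x. ennreal_rpow (e2ennreal \<bar>f x\<bar>) p \<partial>M) (1 / p)"

lemma sets_PiM_borel_eq_sigma_open:
  "sets (Pi\<^sub>M {..<n} (\<lambda>_. borel :: real measure)) =
     sigma_sets (Rn n) {U. openin (powertop_real {..<n}) U}"
proof -
  let ?X = "powertop_real {..<n}"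
  define N where "N = sigma (Rn n) {U. openin ?X U}"
  have top: "topspace ?X = Rn n" by simp
  have Upow: "{U. openin ?X U} \<subseteq> Pow (Rn n)"
    using openin_subset[of ?X] top by auto
  have sN: "space N = Rn n" and setsN: "sets N = sigma_sets (Rn n) {U. openin ?X U}"
    unfolding N_def using Upow by (auto simp: space_measure_of sets_measure_of)
  have proj: "(\<lambda>f. f i) \<in> borel_measurable N" if "i < n" for i
  proof (rule borel_measurableI)
    fix S :: "real set" assume "open S"
    then have "openin ?X {f \<in> topspace ?X. f i \<in> S}"
      using that
      by (intro openin_continuous_map_preimage[OF continuous_map_product_projection]) auto
    moreover have "(\<lambda>f. f i) -` S \<inter> space N = {f \<in> topspace ?X. f i \<in> S}"
      using sN top by auto
    ultimately show "(\<lambda>f. f i) -` S \<inter> space N \<in> sets N"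
      unfolding setsN by auto
  qed
  have "sigma_sets (space N)
      {{f \<in> {..<n} \<rightarrow>\<^sub>E space (borel :: real measure). f i \<in> A} |i A. i \<in> {..<n} \<and> A \<in> sets borel} \<subseteq> sets N"
  proof (rule sets.sigma_sets_subset, rule subsetI)
    fix S assume "S \<in> {{f \<in> {..<n} \<rightarrow>\<^sub>E space (borel :: real measure). f i \<in> A} |i A. i \<in> {..<n} \<and> A \<in> sets borel}"
    then obtain i and A :: "real set" where iA: "i \<in> {..<n}" "A \<in> sets borel"
      and S: "S = {f \<in> {..<n} \<rightarrow>\<^sub>E space (borel :: real measure). f i \<in> A}"
      by blast
    then have "(\<lambda>f. f i) -` A \<inter> space N \<in> sets N"
      by (intro measurable_sets[OF proj]) auto
    moreover have "(\<lambda>f. f i) -` A \<inter> space N = S"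
      unfolding sN S by auto
    ultimately show "S \<in> sets N" by simp
  qed
  then have "sets (Pi\<^sub>M {..<n} (\<lambda>_. borel :: real measure)) \<subseteq> sets N"
    unfolding sN sets_PiM_single by simp
  moreover have "U \<in> sets (Pi\<^sub>M {..<n} (\<lambda>_. borel :: real measure))" if U: "openin ?X U" for U
  proof -
    obtain B :: "real set set" where B: "countable B" "topological_basis B"
      using ex_countable_basis by blast
    define W where "W = {V \<in> {..<n} \<rightarrow>\<^sub>E B. Pi\<^sub>E {..<n} V \<subseteq> U}"
    have "countable ({..<n} \<rightarrow>\<^sub>E B)"
      using B by (intro countable_PiE) auto
    then have cW: "countable W"
      unfolding W_def by (rule countable_subset[rotated]) auto
    have "x \<in> (\<Union>V\<in>W. Pi\<^sub>E {..<n} V)" if x: "x \<in> U" for x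
    proof -
      obtain T where T: "\<forall>i\<in>{..<n}. open (T i)" "x \<in> Pi\<^sub>E {..<n} T" "Pi\<^sub>E {..<n} T \<subseteq> U"
        using U x unfolding openin_product_topology_alt by force
      have "\<forall>i\<in>{..<n}. \<exists>V\<in>B. x i \<in> V \<and> V \<subseteq> T i"
        using T B(2) by (meson PiE_mem topological_basisE)
      then obtain V where V: "\<forall>i\<in>{..<n}. V i \<in> B \<and> x i \<in> V i \<and> V i \<subseteq> T i"
        by metis
      have "Pi\<^sub>E {..<n} (restrict V {..<n}) \<subseteq> Pi\<^sub>E {..<n} T"
        using V by (intro PiE_mono) auto
      then have "restrict V {..<n} \<in> W"
        unfolding W_def using V T(3) by auto
      moreover have "x \<in> Pi\<^sub>E {..<n} (restrict V {..<n})"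
        using V T(2) by (auto simp: PiE_iff)
      ultimately show ?thesis by blast
    qed
    then have "U = (\<Union>V\<in>W. Pi\<^sub>E {..<n} V)"
      unfolding W_def by auto
    moreover have "(\<Union>V\<in>W. Pi\<^sub>E {..<n} V) \<in> sets (Pi\<^sub>M {..<n} (\<lambda>_. borel :: real measure))"
    proof (rule sets.countable_UN''[OF cW])
      fix V assume "V \<in> W"
      then have "V i \<in> sets borel" if "i \<in> {..<n}" for i
        using that topological_basis_open[OF B(2)] unfolding W_def by (auto simp: PiE_iff)
      then show "Pi\<^sub>E {..<n} V \<in> sets (Pi\<^sub>M {..<n} (\<lambda>_. borel :: real measure))"
        by (intro sets_PiM_I_finite) auto
    qed
    ultimately show ?thesis by simp
  qed
  then have "sigma_sets (Rn n) {U. openin ?X U} \<subseteq> sets (Pi\<^sub>M {..<n} (\<lambda>_. borel :: real measure))"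
    using sets.sigma_sets_subset[of "{U. openin ?X U}" "Pi\<^sub>M {..<n} (\<lambda>_. borel :: real measure)"]
    by (auto simp: space_PiM)
  ultimately show ?thesis
    unfolding setsN by auto
qed

end

theory Submission
  imports Defs
begin

text \<open>
A point \<open>x\<close> has Cramer transform greater than \<open>T\<close> iff some \<open>\<theta>\<close> satisfies
\<open>exp (\<theta> \<cdot> x) > exp T * \<integral> exp (\<theta> \<cdot> y) d\<mu>(y)\<close>. The theorem says that few points have this property,
that is, for most \<open>x\<close> the Laplace transform of \<open>\<mu>\<close> is bounded below by a multiple of
\<open>exp (\<theta> \<cdot> x)\<close>, uniformly in \<open>\<theta>\<close>.

Let first \<open>\<mu>\<close> have a bounded log-concave density \<open>f\<close> with supremum \<open>M\<close>. The level set
\<open>{f \<ge> exp (- s) * M}\<close> carries all but \<open>2 ^ n * exp (- s / 2)\<close> of the mass (\<open>level_mass\<close>). Suppose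
\<open>x = (1 - \<eta>) x' + \<eta> y\<close> with \<open>x'\<close> in the level set. Contracting \<open>\<mu>\<close> towards \<open>x'\<close> by the factor \<open>\<eta>\<close>
shows that the Laplace transform at \<open>\<theta>\<close> is at least
\<open>\<eta> ^ n * exp (- s) * exp ((1 - \<eta>) \<theta> \<cdot> x')\<close> times the Laplace transform at \<open>\<eta> \<theta>\<close>
(\<open>laplace_lower_bound\<close>). If more than half of all points \<open>y\<close> are admissible for \<open>x\<close>, then for each
\<open>\<theta>\<close> one of them satisfies \<open>exp (\<eta> \<theta> \<cdot> y) \<le> 2 * \<integral> exp (\<eta> \<theta> \<cdot> z) d\<mu>(z)\<close>, and the Cramer transform at \<open>x\<close>
is at most \<open>ln 2 + s + n * ln (1 / \<eta>)\<close> (\<open>exp_le_laplace_if_anchors\<close>). A change of variables and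
log-concavity show that for small \<open>\<eta>\<close> almost all pairs \<open>(x, y)\<close> are admissible (\<open>anchors_mass\<close>).
With \<open>s\<close> of order \<open>n + w\<close> and \<open>\<eta> = exp (- w) / (n + s)\<close>, the Cramer transform exceeds
\<open>n * ln n + 5 * n * (1 + w)\<close> with probability at most \<open>6 * exp (- w)\<close> (\<open>excess_mass_le_exp\<close>).

For \<open>n \<ge> 2\<close> the constants are absorbed by \<open>ln n\<close>. For \<open>n = 1\<close> the logarithm vanishes and small \<open>u\<close>
require that the transform be below \<open>C * u\<close> with probability at least about \<open>u\<close>. It is convex and
vanishes at the mean, so contracting the set where it is below a constant towards the mean gives
this, provided that the density at the mean is comparable to \<open>M\<close>, which is Jensen's inequality for
\<open>- ln f\<close> (\<open>excess_mass_contract\<close>, \<open>density_at_mean\<close>).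

A general log-concave \<open>\<mu>\<close> is restricted to a large cube and convolved with the uniform law on a
small one. The resulting density at a point is a multiple of the \<open>\<mu>\<close>-mass of a box, so its log-concavity is
the defining inequality of \<open>\<mu>\<close> for boxes. Since the inequality that defines the exceptional points is
strict, the tail bounds pass to the limit by Fatou's lemma (\<open>log_concave_measure_excess_le\<close>). Finally,
summing the tail bound over integer heights gives the moment bound (\<open>cramer_Lp_norm\<close>).
\<close>

section \<open>Lebesgue measure on the extensional model of Euclidean space\<close>

abbreviation leb :: "nat \<Rightarrow> (nat \<Rightarrow> real) measure" where
  "leb n \<equiv> Pi\<^sub>M {..<n} (\<lambda>_. lborel)"

definition comb :: "nat \<Rightarrow> real \<Rightarrow> (nat \<Rightarrow> real) \<Rightarrow> (nat \<Rightarrow> real) \<Rightarrow> nat \<Rightarrow> real" where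
  "comb n l x y = (\<lambda>i\<in>{..<n}. l * x i + (1 - l) * y i)"

definition cube :: "nat \<Rightarrow> real \<Rightarrow> (nat \<Rightarrow> real) set" where
  "cube n r = ({..<n} \<rightarrow>\<^sub>E {-r..r})"

lemma sets_leb: "sets (leb n) = sets (Pi\<^sub>M {..<n} (\<lambda>_. borel :: real measure))"
  by (intro sets_PiM_cong) auto

lemma space_leb [simp]: "space (leb n) = Rn n"
  by (simp add: space_PiM)

lemma sigma_finite_leb: "sigma_finite_measure (leb n)"
proof -
  interpret product_sigma_finite "\<lambda>_::nat. lborel :: real measure" ..
  show ?thesis by (rule sigma_finite) auto
qed

lemma comb_in_Rn [simp]: "comb n l x y \<in> Rn n"
  by (auto simp: comb_def)

lemma dot_comb: "dot n \<theta> (comb n l x y) = l * dot n \<theta> x + (1 - l) * dot n \<theta> y"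
  by (simp add: dot_def comb_def sum_distrib_left sum.distrib[symmetric] algebra_simps)

lemma comb_comb: "comb n a (comb n b x y) y = comb n (a * b) x y"
  by (auto simp: comb_def fun_eq_iff algebra_simps)

lemma comb_one: "x \<in> Rn n \<Longrightarrow> comb n 1 x y = x"
  by (auto simp: comb_def fun_eq_iff PiE_iff extensional_def)

lemma measurable_dot [measurable]: "dot n \<theta> \<in> borel_measurable (leb n)"
  unfolding dot_def by measurable

lemma measurable_comb [measurable]:
  assumes "f \<in> measurable M (leb n)" "g \<in> measurable M (leb n)"
  shows "(\<lambda>z. comb n l (f z) (g z)) \<in> measurable M (leb n)"
proof -
  have [measurable]: "(\<lambda>z. f z i) \<in> borel_measurable M" "(\<lambda>z. g z i) \<in> borel_measurable M"
    if "i < n" for i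
    using measurable_compose[OF assms(1) measurable_component_singleton[of i "{..<n}" "\<lambda>_. lborel"]]
      measurable_compose[OF assms(2) measurable_component_singleton[of i "{..<n}" "\<lambda>_. lborel"]] that
    by auto
  show ?thesis unfolding comb_def
    by (intro measurable_restrict) (auto simp: measurable_lborel2)
qed

lemma measurable_affine:
  "(\<lambda>x. \<lambda>i\<in>{..<n}. a i + c * x i) \<in> measurable (leb n) (leb n)"
  by (intro measurable_restrict) auto

text \<open>
Both measures agree on boxes, where the identity reduces to the one-dimensional one.
\<close>

lemma leb_affine:
  assumes c: "c > 0"
  shows "leb n = scale_measure (ennreal (c ^ n))
           (distr (leb n) (leb n) (\<lambda>x. \<lambda>i\<in>{..<n}. a i + c * x i))"
proof -
  interpret product_sigma_finite "\<lambda>_::nat. lborel :: real measure" ..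
  let ?T = "\<lambda>x. \<lambda>i\<in>{..<n}. a i + c * x i"
  have T[measurable]: "?T \<in> measurable (leb n) (leb n)" by (rule measurable_affine)
  have "scale_measure (ennreal (c ^ n)) (distr (leb n) (leb n) ?T) = leb n"
  proof (rule PiM_eqI)
    fix A :: "nat \<Rightarrow> real set"
    assume A: "\<And>i. i \<in> {..<n} \<Longrightarrow> A i \<in> sets lborel"
    have 1: "emeasure lborel (A i) = ennreal c * emeasure lborel ((\<lambda>t. a i + c * t) -` A i)"
      if i: "i \<in> {..<n}" for i
    proof -
      have [measurable]: "A i \<in> sets borel" using A[OF i] by simp
      have B: "(\<lambda>t. a i + c * t) -` A i \<in> sets borel"
        using measurable_sets_borel[of "\<lambda>t. a i + c * t" borel "A i"] by auto
      have "emeasure lborel (A i) = (\<integral>\<^sup>+t. indicator (A i) t \<partial>lborel)" by simp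
      also have "\<dots> = ennreal \<bar>c\<bar> * (\<integral>\<^sup>+t. indicator (A i) (a i + c * t) \<partial>lborel)"
        by (rule nn_integral_real_affine) (use c in auto)
      also have "(\<integral>\<^sup>+t. indicator (A i) (a i + c * t) \<partial>lborel)
          = (\<integral>\<^sup>+t. indicator ((\<lambda>t. a i + c * t) -` A i) t \<partial>lborel)"
        by (intro nn_integral_cong) (auto simp: indicator_def)
      finally show ?thesis using c B by simp
    qed
    have "?T -` (Pi\<^sub>E {..<n} A) \<inter> space (leb n) = Pi\<^sub>E {..<n} (\<lambda>i. (\<lambda>t. a i + c * t) -` A i)"
      by (auto simp: PiE_iff)
    moreover have "(\<lambda>t. a i + c * t) -` A i \<in> sets lborel" if i: "i \<in> {..<n}" for i
      using A[OF i] measurable_sets_borel[of "\<lambda>t. a i + c * t" borel "A i"] by auto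
    ultimately have "emeasure (distr (leb n) (leb n) ?T) (Pi\<^sub>E {..<n} A)
        = (\<Prod>i<n. emeasure lborel ((\<lambda>t. a i + c * t) -` A i))"
      using A by (subst emeasure_distr) (auto intro!: sets_PiM_I_finite emeasure_PiM)
    moreover have "(\<Prod>i<n. emeasure lborel (A i))
        = (\<Prod>i<n. ennreal c * emeasure lborel ((\<lambda>t. a i + c * t) -` A i))"
      by (intro prod.cong refl) (simp add: 1)
    ultimately show "emeasure (scale_measure (ennreal (c ^ n)) (distr (leb n) (leb n) ?T)) (Pi\<^sub>E {..<n} A)
        = (\<Prod>i\<in>{..<n}. emeasure lborel (A i))"
      using c by (simp add: prod.distrib ennreal_power)
  qed auto
  then show ?thesis by simp
qed

lemma nn_integral_leb_affine:
  assumes c: "c > 0" and h: "h \<in> borel_measurable (leb n)"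
  shows "(\<integral>\<^sup>+x. h x \<partial>leb n) = ennreal (c ^ n) * (\<integral>\<^sup>+x. h (\<lambda>i\<in>{..<n}. a i + c * x i) \<partial>leb n)"
  using h measurable_affine[where n = n and a = a and c = c]
  by (subst leb_affine[OF c, where n = n and a = a]) (simp add: nn_integral_scale_measure nn_integral_distr)

lemma nn_integral_leb_comb:
  assumes "l > 0" "h \<in> borel_measurable (leb n)"
  shows "(\<integral>\<^sup>+x. h x \<partial>leb n) = ennreal (l ^ n) * (\<integral>\<^sup>+x. h (comb n l x y) \<partial>leb n)"
  using nn_integral_leb_affine[OF assms, where a = "\<lambda>i. (1 - l) * y i"]
  by (simp add: comb_def add.commute)

lemma cube_iff: "x \<in> cube n r \<longleftrightarrow> x \<in> Rn n \<and> (\<forall>i<n. \<bar>x i\<bar> \<le> r)"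
  by (auto simp: cube_def PiE_iff abs_le_iff minus_le_iff)

lemma cube_sets [measurable]: "cube n r \<in> sets (leb n)"
  unfolding cube_def by (intro sets_PiM_I_finite) auto

lemma emeasure_leb_cube: "r \<ge> 0 \<Longrightarrow> emeasure (leb n) (cube n r) = ennreal ((2 * r) ^ n)"
proof -
  interpret product_sigma_finite "\<lambda>_::nat. lborel :: real measure" ..
  assume "r \<ge> 0"
  then show ?thesis unfolding cube_def
    by (subst emeasure_PiM) (auto simp: ennreal_power)
qed

lemma leb_coordinate_null:
  assumes "i < n"
  shows "AE x in leb n. x i \<noteq> t"
proof -
  interpret product_sigma_finite "\<lambda>_::nat. lborel :: real measure" ..
  have "emeasure (leb n) (Pi\<^sub>E {..<n} (\<lambda>j. if j = i then {t} else UNIV)) = 0"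
    using assms by (subst emeasure_PiM) (auto intro!: prod_zero bexI[of _ i])
  moreover have "Pi\<^sub>E {..<n} (\<lambda>j. if j = i then {t} else UNIV) \<in> sets (leb n)"
    by (intro sets_PiM_I_finite) auto
  moreover have "{x \<in> space (leb n). x i = t} \<subseteq> Pi\<^sub>E {..<n} (\<lambda>j. if j = i then {t} else UNIV)"
    by (auto simp: PiE_iff extensional_def)
  ultimately show ?thesis
    by (intro AE_I[where N = "Pi\<^sub>E {..<n} (\<lambda>j. if j = i then {t} else UNIV)"]) auto
qed

section \<open>The set where the Cramer transform is large\<close>

definition laplace :: "nat \<Rightarrow> (nat \<Rightarrow> real) measure \<Rightarrow> (nat \<Rightarrow> real) \<Rightarrow> ennreal" where
  "laplace n \<mu> \<theta> = (\<integral>\<^sup>+x. ennreal (exp (dot n \<theta> x)) \<partial>\<mu>)"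

text \<open>
The set where the Cramer transform exceeds \<open>T\<close> (lemma \<open>cramer_gt_iff\<close>), with logarithms and
suprema removed. It is a union of sets of the form \<open>{x. c < \<theta> \<cdot> x}\<close>, hence open and measurable.
\<close>

definition excess :: "nat \<Rightarrow> (nat \<Rightarrow> real) measure \<Rightarrow> real \<Rightarrow> (nat \<Rightarrow> real) set" where
  "excess n \<mu> T =
     {x \<in> Rn n. \<exists>\<theta>\<in>Rn n. ennreal (exp T) * laplace n \<mu> \<theta> < ennreal (exp (dot n \<theta> x))}"

lemma excess_subset: "excess n \<mu> T \<subseteq> Rn n"
  by (auto simp: excess_def)

lemma continuous_map_dot:
  "continuous_map (powertop_real {..<n}) euclideanreal (dot n \<theta>)"
  unfolding dot_def
  by (intro continuous_map_sum continuous_map_real_mult continuous_map_product_projection) auto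

lemma excess_sets: "excess n \<mu> T \<in> sets (leb n)"
proof -
  have "openin (powertop_real {..<n}) (excess n \<mu> T)"
  proof -
    have eq: "excess n \<mu> T = (\<Union>\<theta>\<in>Rn n.
        {x \<in> topspace (powertop_real {..<n}).
           dot n \<theta> x \<in> {t. ennreal (exp T) * laplace n \<mu> \<theta> < ennreal (exp t)}})"
      by (auto simp: excess_def)
    have "open {t::real. ennreal (exp T) * laplace n \<mu> \<theta> < ennreal (exp t)}" for \<theta>
      by (intro open_Collect_less continuous_on_ennreal continuous_intros)
    then have "openin (powertop_real {..<n}) {x \<in> topspace (powertop_real {..<n}).
           dot n \<theta> x \<in> {t. ennreal (exp T) * laplace n \<mu> \<theta> < ennreal (exp t)}}" for \<theta>
      by (intro openin_continuous_map_preimage[OF continuous_map_dot]) (simp only: open_openin)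
    then show ?thesis unfolding eq by (intro openin_Union) blast
  qed
  then show ?thesis
    unfolding sets_leb sets_PiM_borel_eq_sigma_open by blast
qed

lemma laplace_pos:
  assumes "prob_space \<mu>" "sets \<mu> = sets (leb n)"
  shows "laplace n \<mu> \<theta> > 0"
proof -
  interpret prob_space \<mu> by fact
  have [measurable]: "dot n \<theta> \<in> borel_measurable \<mu>"
    using measurable_dot[of n \<theta>] assms(2) measurable_cong_sets by blast
  have "laplace n \<mu> \<theta> \<noteq> 0"
  proof
    assume "laplace n \<mu> \<theta> = 0"
    then have "AE x in \<mu>. ennreal (exp (dot n \<theta> x)) = 0"
      unfolding laplace_def by (subst (asm) nn_integral_0_iff_AE) auto
    then have "AE x in \<mu>. False"
      by (auto simp: ennreal_eq_0_iff)
    then show False by simp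
  qed
  then show ?thesis by (simp add: zero_less_iff_neq_zero)
qed

lemma cramer_gt_iff:
  assumes "prob_space \<mu>" "sets \<mu> = sets (leb n)" "x \<in> Rn n"
  shows "cramer n \<mu> x > ereal T \<longleftrightarrow> x \<in> excess n \<mu> T"
proof -
  have "ereal T < ereal (dot n \<theta> x) - log_laplace n \<mu> \<theta> \<longleftrightarrow>
        ennreal (exp T) * laplace n \<mu> \<theta> < ennreal (exp (dot n \<theta> x))" for \<theta>
  proof (cases "laplace n \<mu> \<theta> = \<infinity>")
    case True
    then show ?thesis
      by (simp add: log_laplace_def laplace_def ennreal_mult_top)
  next
    case False
    then obtain r where r: "laplace n \<mu> \<theta> = ennreal r" "r \<ge> 0"
      by (cases "laplace n \<mu> \<theta>") auto
    with laplace_pos[OF assms(1,2), of \<theta>] have "r > 0" by auto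
    then have "T < dot n \<theta> x - ln r \<longleftrightarrow> exp T * r < exp (dot n \<theta> x)"
      by (metis exp_add exp_less_cancel_iff exp_ln less_diff_eq)
    moreover have "log_laplace n \<mu> \<theta> = ereal (ln r)"
      using False r unfolding log_laplace_def laplace_def[symmetric] by (simp add: Let_def)
    ultimately show ?thesis
      using r by (simp add: ennreal_mult[symmetric] ennreal_less_iff)
  qed
  then show ?thesis
    using assms(3) by (auto simp: cramer_def less_SUP_iff excess_def)
qed

section \<open>Log-concave densities and their level sets\<close>

text \<open>
Applied to \<open>a = f x\<close> and \<open>b = f y\<close>, this turns log-concavity at a pair of points into a
comparison with \<open>f x\<close> itself when \<open>f y\<close> is within the factor \<open>exp (- s)\<close> of the maximum \<open>m\<close>: the
loss is only the power \<open>1 - \<eta>\<close> of that factor, hence negligible for \<open>\<eta>\<close> close to 1.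
\<close>

lemma weighted_powr_lower:
  fixes a b m s \<eta> :: real
  assumes "0 \<le> a" "a \<le> m" "exp (- s) * m \<le> b" "0 < \<eta>" "\<eta> < 1"
  shows "a * exp (- (s * (1 - \<eta>))) \<le> a powr \<eta> * b powr (1 - \<eta>)"
proof (cases "a = 0")
  case False
  then have a: "a > 0" and m: "m > 0" using assms by auto
  have "a * exp (- (s * (1 - \<eta>))) = a powr \<eta> * (a powr (1 - \<eta>) * exp (- (s * (1 - \<eta>))))"
    using a by (simp add: powr_add[symmetric])
  also have "\<dots> \<le> a powr \<eta> * (m powr (1 - \<eta>) * exp (- (s * (1 - \<eta>))))"
    using assms a by (intro mult_left_mono mult_right_mono powr_mono2) auto
  also have "m powr (1 - \<eta>) * exp (- (s * (1 - \<eta>))) = (exp (- s) * m) powr (1 - \<eta>)"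
    using m by (simp add: powr_mult exp_powr_real mult.commute)
  also have "a powr \<eta> * \<dots> \<le> a powr \<eta> * b powr (1 - \<eta>)"
    using assms a m by (intro mult_left_mono powr_mono2) auto
  finally show ?thesis .
qed simp

text \<open>
Boundedness and bounded support are properties of the approximating densities constructed below;
they make \<open>peak\<close> finite and give all exponential moments.
\<close>

locale log_concave_density =
  fixes n :: nat and f :: "(nat \<Rightarrow> real) \<Rightarrow> real"
  assumes f_measurable [measurable]: "f \<in> borel_measurable (leb n)"
    and f_nonneg: "\<And>x. 0 \<le> f x"
    and f_bounded: "\<exists>B. \<forall>x. f x \<le> B"
    and f_log_concave: "\<And>x y l. x \<in> Rn n \<Longrightarrow> y \<in> Rn n \<Longrightarrow> 0 < l \<Longrightarrow> l < 1 \<Longrightarrow>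
          f x powr l * f y powr (1 - l) \<le> f (comb n l x y)"
    and f_integral: "(\<integral>\<^sup>+x. ennreal (f x) \<partial>leb n) = 1"
    and f_support: "\<exists>R. \<forall>x\<in>Rn n. f x \<noteq> 0 \<longrightarrow> x \<in> cube n R"
begin

definition peak :: real where
  "peak = (SUP x\<in>Rn n. f x)"

definition law :: "(nat \<Rightarrow> real) measure" where
  "law = density (leb n) (\<lambda>x. ennreal (f x))"

lemma Rn_nonempty: "Rn n \<noteq> {}"
  by (auto simp: PiE_eq_empty_iff)

lemma f_le_peak: "x \<in> Rn n \<Longrightarrow> f x \<le> peak"
  unfolding peak_def using f_bounded by (auto intro!: cSUP_upper bdd_aboveI2)

lemma peak_pos: "peak > 0"
proof (rule ccontr)
  assume "\<not> peak > 0"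
  then have "f x = 0" if "x \<in> Rn n" for x
    using f_le_peak[OF that] f_nonneg[of x] by linarith
  then have "(\<integral>\<^sup>+x. ennreal (f x) \<partial>leb n) = (\<integral>\<^sup>+x. 0 \<partial>leb n)"
    by (intro nn_integral_cong) auto
  then show False using f_integral by simp
qed

lemma sets_law [measurable_cong, simp]: "sets law = sets (leb n)"
  by (simp add: law_def)

lemma space_law [simp]: "space law = Rn n"
  using sets_eq_imp_space_eq[OF sets_law] by simp

lemma nn_integral_law:
  "h \<in> borel_measurable (leb n) \<Longrightarrow> (\<integral>\<^sup>+x. h x \<partial>law) = (\<integral>\<^sup>+x. ennreal (f x) * h x \<partial>leb n)"
  unfolding law_def by (intro nn_integral_density) auto

lemma prob_space_law: "prob_space law"
proof
  have "emeasure law (space law) = (\<integral>\<^sup>+x. 1 \<partial>law)"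
    by simp
  also have "\<dots> = 1"
    by (subst nn_integral_law) (auto simp: f_integral)
  finally show "emeasure law (space law) = 1" .
qed

sublocale law: prob_space law
  by (rule prob_space_law)

text \<open>
Log-concavity at midpoints gives \<open>sqrt (f x) * sqrt (f y) \<le> f ((x + y) / 2)\<close>; integrate over \<open>y\<close>
and let \<open>f x\<close> approach the supremum.
\<close>

lemma sqrt_density_integral:
  "ennreal (sqrt peak) * (\<integral>\<^sup>+y. ennreal (sqrt (f y)) \<partial>leb n) \<le> 2 ^ n"
proof -
  let ?J = "\<integral>\<^sup>+y. ennreal (sqrt (f y)) \<partial>leb n"
  have two: "2 ^ n * ennreal ((1/2) ^ n) = 1"
  proof -
    have "2 ^ n * ennreal ((1/2) ^ n) = ennreal (2 ^ n) * ennreal ((1/2) ^ n)"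
      by (simp add: ennreal_power[symmetric])
    also have "\<dots> = ennreal (2 ^ n * (1/2) ^ n)" by (rule ennreal_mult[symmetric]) auto
    also have "2 ^ n * (1/2) ^ n = (1::real)" by (simp add: power_mult_distrib[symmetric])
    finally show ?thesis by simp
  qed
  have le: "ennreal (sqrt (f x)) * ?J \<le> 2 ^ n" if x: "x \<in> Rn n" for x
  proof -
    have "ennreal (sqrt (f x)) * ?J = (\<integral>\<^sup>+y. ennreal (sqrt (f x) * sqrt (f y)) \<partial>leb n)"
      by (subst nn_integral_cmult[symmetric]) (auto simp: ennreal_mult f_nonneg)
    also have "\<dots> \<le> (\<integral>\<^sup>+y. ennreal (f (comb n (1/2) y x)) \<partial>leb n)"
      using f_log_concave[OF _ x, of _ "1/2"] f_nonneg
      by (intro nn_integral_mono ennreal_leI) (auto simp: powr_half_sqrt mult.commute)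
    also have "\<dots> = 2 ^ n * (ennreal ((1/2) ^ n) * \<dots>)"
      using two by (simp add: mult.assoc[symmetric])
    also have "ennreal ((1/2) ^ n) * (\<integral>\<^sup>+y. ennreal (f (comb n (1/2) y x)) \<partial>leb n) = 1"
      using nn_integral_leb_comb[of "1/2" "\<lambda>x. ennreal (f x)" n x] f_integral by simp
    finally show ?thesis by simp
  qed
  obtain x0 where x0: "x0 \<in> Rn n" "f x0 > 0"
    using peak_pos Rn_nonempty unfolding peak_def
    by (metis (no_types, lifting) cSUP_least not_less)
  have "?J \<noteq> \<infinity>"
  proof
    assume "?J = \<infinity>"
    then show False using le[OF x0(1)] x0(2)
      by (simp add: ennreal_mult_top top_unique power_eq_top_ennreal)
  qed
  then obtain j where j: "?J = ennreal j" "j \<ge> 0" by (cases ?J) auto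
  have "sqrt peak * j \<le> 2 ^ n"
  proof (cases "j = 0")
    case False
    then have j0: "j > 0" using j by simp
    have "f x \<le> (2 ^ n / j)\<^sup>2" if "x \<in> Rn n" for x
    proof -
      have "ennreal (sqrt (f x) * j) \<le> ennreal (2 ^ n)"
        using le[OF that] j f_nonneg[of x] by (simp add: ennreal_mult ennreal_power[symmetric])
      then have "sqrt (f x) * j \<le> 2 ^ n" by (subst (asm) ennreal_le_iff) auto
      then have "sqrt (f x) \<le> 2 ^ n / j" using j0 by (simp add: field_simps)
      then show ?thesis using sqrt_le_D by blast
    qed
    then have "peak \<le> (2 ^ n / j)\<^sup>2"
      unfolding peak_def using Rn_nonempty by (intro cSUP_least) auto
    then have "sqrt peak \<le> 2 ^ n / j"
      using j0 by (intro real_le_lsqrt) (auto simp: peak_pos less_imp_le)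
    then show ?thesis using j0 by (simp add: field_simps)
  qed simp
  then have "ennreal (sqrt peak * j) \<le> ennreal (2 ^ n)" by (rule ennreal_leI)
  then show ?thesis
    using j peak_pos by (simp add: ennreal_mult ennreal_power[symmetric])
qed

definition level :: "real \<Rightarrow> (nat \<Rightarrow> real) set" where
  "level s = {x \<in> Rn n. exp (- s) * peak \<le> f x}"

lemma level_sets [measurable]: "level s \<in> sets (leb n)"
proof -
  have "{x \<in> space (leb n). exp (- s) * peak \<le> f x} \<in> sets (leb n)" by measurable
  then show ?thesis by (simp add: level_def)
qed

text \<open>
Off the level set, \<open>f\<close> is at most \<open>exp (- s / 2) * sqrt peak * sqrt f\<close>.
\<close>

lemma level_mass: "measure law (level s) \<ge> 1 - 2 ^ n * exp (- s / 2)"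
proof -
  let ?A = "Rn n - level s"
  have sqrt_exp: "sqrt (exp (- s)) = exp (- s / 2)"
    by (rule real_sqrt_unique) (auto simp: power2_eq_square exp_add[symmetric])
  have A: "?A \<in> sets (leb n)" using sets.compl_sets[OF level_sets[of s]] by simp
  have "emeasure law ?A = (\<integral>\<^sup>+x. ennreal (f x) * indicator ?A x \<partial>leb n)"
    using A by (simp add: law_def emeasure_density)
  also have "\<dots> \<le> (\<integral>\<^sup>+x. ennreal (exp (- s / 2)) * (ennreal (sqrt peak) * ennreal (sqrt (f x))) \<partial>leb n)"
  proof (rule nn_integral_mono)
    fix x :: "nat \<Rightarrow> real" assume x: "x \<in> space (leb n)"
    have "f x \<le> exp (- s / 2) * (sqrt peak * sqrt (f x))" if "x \<in> ?A"
    proof -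
      have "f x \<le> exp (- s) * peak" using that by (simp add: level_def not_le less_imp_le)
      then have "sqrt (f x) \<le> sqrt (exp (- s) * peak)" by simp
      also have "\<dots> = exp (- s / 2) * sqrt peak"
        by (simp only: real_sqrt_mult sqrt_exp)
      finally have "sqrt (f x) * sqrt (f x) \<le> exp (- s / 2) * sqrt peak * sqrt (f x)"
        by (intro mult_right_mono) (auto simp: f_nonneg)
      then show ?thesis using f_nonneg[of x] by (simp add: mult.assoc)
    qed
    then show "ennreal (f x) * indicator ?A x
        \<le> ennreal (exp (- s / 2)) * (ennreal (sqrt peak) * ennreal (sqrt (f x)))"
      using peak_pos f_nonneg[of x]
      by (auto simp: indicator_def ennreal_mult[symmetric] intro!: ennreal_leI)
  qed
  also have "\<dots> = ennreal (exp (- s / 2)) * (ennreal (sqrt peak) * (\<integral>\<^sup>+x. ennreal (sqrt (f x)) \<partial>leb n))"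
    by (simp add: nn_integral_cmult)
  also have "\<dots> \<le> ennreal (exp (- s / 2)) * 2 ^ n"
    by (intro mult_left_mono sqrt_density_integral) auto
  also have "\<dots> = ennreal (2 ^ n * exp (- s / 2))"
    by (simp add: ennreal_mult ennreal_power[symmetric] mult.commute)
  finally have "measure law ?A \<le> 2 ^ n * exp (- s / 2)"
    by (simp add: law.emeasure_eq_measure)
  moreover have "measure law ?A = 1 - measure law (level s)"
    using law.prob_compl[of "level s"] by simp
  ultimately show ?thesis by simp
qed

end

section \<open>Lower bounds for the Laplace transform\<close>

lemma ennreal_mult_triple:
  "0 \<le> a \<Longrightarrow> 0 \<le> b \<Longrightarrow> ennreal a * (ennreal b * ennreal c) = ennreal (a * (b * c))"
  by (simp add: ennreal_mult')

context log_concave_density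
begin

lemma log_concave_level:
  assumes "x \<in> Rn n" "y \<in> Rn n" "0 < l" "l < 1" "exp (- s) * peak \<le> f y"
  shows "f x * exp (- (s * (1 - l))) \<le> f (comb n l x y)"
  using weighted_powr_lower[OF f_nonneg[of x] f_le_peak[OF assms(1)] assms(5,3,4)]
    f_log_concave[OF assms(1-4)] by linarith

lemma measurable_comb_left [measurable]: "(\<lambda>x. comb n l x y) \<in> measurable (leb n) (leb n)"
  if "y \<in> Rn n"
  using that by (intro measurable_comb) auto

text \<open>
The whole measure is contracted towards \<open>x\<close> by the factor \<open>\<eta>\<close>: substituting
\<open>z = \<eta> y + (1 - \<eta>) x\<close> costs the Jacobian \<open>\<eta> ^ n\<close>, and log-concavity with \<open>f x\<close> near the peak
bounds \<open>f z\<close> below by \<open>exp (- s) * f y\<close>.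
\<close>

lemma laplace_lower_bound:
  assumes x: "x \<in> level s" and \<eta>: "0 < \<eta>" "\<eta> < 1" and s: "0 \<le> s"
  shows "ennreal (\<eta> ^ n * exp (- s) * exp ((1 - \<eta>) * dot n \<theta> x)) *
           (\<integral>\<^sup>+y. ennreal (exp (\<eta> * dot n \<theta> y)) \<partial>law) \<le> laplace n law \<theta>"
proof -
  have x': "x \<in> Rn n" "exp (- s) * peak \<le> f x" using x by (auto simp: level_def)
  note [measurable] = measurable_comb_left[OF x'(1)]
  have "ennreal (\<eta> ^ n * exp (- s) * exp ((1 - \<eta>) * dot n \<theta> x)) *
           (\<integral>\<^sup>+y. ennreal (exp (\<eta> * dot n \<theta> y)) \<partial>law)
      = (\<integral>\<^sup>+y. ennreal (\<eta> ^ n * exp (- s) * exp ((1 - \<eta>) * dot n \<theta> x)) *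
            (ennreal (f y) * ennreal (exp (\<eta> * dot n \<theta> y))) \<partial>leb n)"
    by (simp add: nn_integral_law nn_integral_cmult)
  also have "\<dots> \<le> (\<integral>\<^sup>+y. ennreal (\<eta> ^ n) *
      (ennreal (f (comb n \<eta> y x)) * ennreal (exp (dot n \<theta> (comb n \<eta> y x)))) \<partial>leb n)"
  proof (rule nn_integral_mono)
    fix y :: "nat \<Rightarrow> real" assume "y \<in> space (leb n)"
    then have y: "y \<in> Rn n" by simp
    have "f y * exp (- s) \<le> f y * exp (- (s * (1 - \<eta>)))"
      using \<eta> s f_nonneg[of y] by (intro mult_left_mono) (auto simp: mult_left_le)
    also have "\<dots> \<le> f (comb n \<eta> y x)"
      by (rule log_concave_level[OF y x'(1) \<eta> x'(2)])
    finally have "(f y * exp (- s)) * exp (dot n \<theta> (comb n \<eta> y x))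
        \<le> f (comb n \<eta> y x) * exp (dot n \<theta> (comb n \<eta> y x))"
      by (intro mult_right_mono) auto
    then have "\<eta> ^ n * ((f y * exp (- s)) * exp (dot n \<theta> (comb n \<eta> y x)))
        \<le> \<eta> ^ n * (f (comb n \<eta> y x) * exp (dot n \<theta> (comb n \<eta> y x)))"
      using \<eta> by (intro mult_left_mono) auto
    note h = this
    have e: "\<eta> ^ n * exp (- s) * exp ((1 - \<eta>) * dot n \<theta> x) * (f y * exp (\<eta> * dot n \<theta> y))
        = \<eta> ^ n * ((f y * exp (- s)) * exp (dot n \<theta> (comb n \<eta> y x)))"
      by (simp add: dot_comb exp_add)
    have "ennreal (\<eta> ^ n * exp (- s) * exp ((1 - \<eta>) * dot n \<theta> x) * (f y * exp (\<eta> * dot n \<theta> y)))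
        \<le> ennreal (\<eta> ^ n * (f (comb n \<eta> y x) * exp (dot n \<theta> (comb n \<eta> y x))))"
      unfolding e by (rule ennreal_leI[OF h])
    then show "ennreal (\<eta> ^ n * exp (- s) * exp ((1 - \<eta>) * dot n \<theta> x)) *
            (ennreal (f y) * ennreal (exp (\<eta> * dot n \<theta> y)))
      \<le> ennreal (\<eta> ^ n) * (ennreal (f (comb n \<eta> y x)) * ennreal (exp (dot n \<theta> (comb n \<eta> y x))))"
      using \<eta> by (subst (1 2) ennreal_mult_triple) (simp_all add: f_nonneg)
  qed
  also have "\<dots> = ennreal (\<eta> ^ n) * (\<integral>\<^sup>+y. ennreal (f (comb n \<eta> y x)) *
      ennreal (exp (dot n \<theta> (comb n \<eta> y x))) \<partial>leb n)"
    by (subst nn_integral_cmult) auto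
  also have "\<dots> = (\<integral>\<^sup>+y. ennreal (f y) * ennreal (exp (dot n \<theta> y)) \<partial>leb n)"
    using nn_integral_leb_comb[OF \<eta>(1), of "\<lambda>y. ennreal (f y) * ennreal (exp (dot n \<theta> y))" n x]
    by simp
  also have "\<dots> = laplace n law \<theta>"
    by (simp add: laplace_def nn_integral_law)
  finally show ?thesis .
qed

text \<open>
With \<open>x' = comb n (1 / (1 - \<eta>)) x y\<close> one has \<open>x = (1 - \<eta>) x' + \<eta> y\<close>. So \<open>y\<close> is an anchor of \<open>x\<close> if
extrapolating from \<open>y\<close> slightly beyond \<open>x\<close> ends in the level set.
\<close>

definition anchors :: "real \<Rightarrow> real \<Rightarrow> (nat \<Rightarrow> real) \<Rightarrow> (nat \<Rightarrow> real) set" where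
  "anchors \<eta> s x = {y \<in> Rn n. comb n (1 / (1 - \<eta>)) x y \<in> level s}"

lemma anchors_sets [measurable]: "x \<in> Rn n \<Longrightarrow> anchors \<eta> s x \<in> sets (leb n)"
proof -
  assume x: "x \<in> Rn n"
  have [measurable]: "(\<lambda>y. comb n (1 / (1 - \<eta>)) x y) \<in> measurable (leb n) (leb n)"
    using x by (intro measurable_comb) auto
  have "{y \<in> space (leb n). comb n (1 / (1 - \<eta>)) x y \<in> level s} \<in> sets (leb n)"
    by measurable
  then show ?thesis by (simp add: anchors_def)
qed

text \<open>
By Markov's inequality, \<open>exp (\<eta> \<theta> \<cdot> y)\<close> is at most twice its mean for at least half of the points
\<open>y\<close>, so some anchor \<open>y\<close> has this property. The anchor depends on \<open>\<theta>\<close>, but the resulting bound does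
not: inserting it in \<open>laplace_lower_bound\<close>, the exponents \<open>(1 - \<eta>) \<theta> \<cdot> x'\<close> and \<open>\<eta> \<theta> \<cdot> y\<close> add up to
\<open>\<theta> \<cdot> x\<close>.
\<close>

lemma exp_le_laplace_if_anchors:
  assumes x: "x \<in> Rn n" and g: "measure law (anchors \<eta> s x) > 1 / 2"
    and \<eta>: "0 < \<eta>" "\<eta> < 1" and s: "0 \<le> s"
  shows "ennreal (exp (dot n \<theta> x)) \<le> ennreal (2 * exp s / \<eta> ^ n) * laplace n law \<theta>"
proof -
  let ?J = "\<integral>\<^sup>+y. ennreal (exp (\<eta> * dot n \<theta> y)) \<partial>law"
  have G[measurable]: "anchors \<eta> s x \<in> sets law" using anchors_sets[OF x] by simp
  have "\<exists>y\<in>anchors \<eta> s x. ennreal (exp (\<eta> * dot n \<theta> y)) \<le> 2 * ?J"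
  proof (rule ccontr)
    assume "\<not> ?thesis"
    then have lt: "2 * ?J < ennreal (exp (\<eta> * dot n \<theta> y))" if "y \<in> anchors \<eta> s x" for y
      using that by (auto simp: not_le)
    have ne: "anchors \<eta> s x \<noteq> {}" using g by auto
    then have "?J \<noteq> \<infinity>" using lt by fastforce
    then obtain j where j: "?J = ennreal j" "j \<ge> 0" by (cases ?J) auto
    have "ennreal (2 * j * measure law (anchors \<eta> s x)) = (\<integral>\<^sup>+y. 2 * ?J * indicator (anchors \<eta> s x) y \<partial>law)"
      using j anchors_sets[OF x, of \<eta> s] by (subst nn_integral_cmult)
        (auto simp: law.emeasure_eq_measure ennreal_mult mult.assoc)
    also have "\<dots> \<le> ?J"
      using lt by (intro nn_integral_mono) (auto simp: indicator_def less_imp_le)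
    finally have "2 * j * measure law (anchors \<eta> s x) \<le> j"
      using j by (simp add: ennreal_le_iff)
    moreover have "j \<noteq> 0"
    proof
      assume "j = 0"
      then have "?J = 0" using j by simp
      then have "AE y in law. ennreal (exp (\<eta> * dot n \<theta> y)) = 0"
        by (subst (asm) nn_integral_0_iff_AE) auto
      then have "AE y in law. False" by (auto simp: ennreal_eq_0_iff)
      then show False by simp
    qed
    ultimately show False using j g by (auto simp: mult_le_cancel_left1)
  qed
  then obtain y where y: "y \<in> anchors \<eta> s x" "ennreal (exp (\<eta> * dot n \<theta> y)) \<le> 2 * ?J" by blast
  define x' where "x' = comb n (1 / (1 - \<eta>)) x y"
  have x': "x' \<in> level s" using y(1) by (simp add: anchors_def x'_def)
  have "x = comb n (1 - \<eta>) x' y"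
    using \<eta> x by (simp add: x'_def comb_comb comb_one)
  then have dx: "dot n \<theta> x = (1 - \<eta>) * dot n \<theta> x' + \<eta> * dot n \<theta> y"
    by (simp add: dot_comb)
  let ?c = "\<eta> ^ n * exp (- s) * exp ((1 - \<eta>) * dot n \<theta> x')"
  have "ennreal (exp (dot n \<theta> x)) = ennreal (exp ((1 - \<eta>) * dot n \<theta> x')) * ennreal (exp (\<eta> * dot n \<theta> y))"
    by (simp add: dx exp_add ennreal_mult)
  also have "\<dots> \<le> ennreal (exp ((1 - \<eta>) * dot n \<theta> x')) * (2 * ?J)"
    by (intro mult_left_mono y) auto
  also have "ennreal (exp ((1 - \<eta>) * dot n \<theta> x')) = ennreal (exp s / \<eta> ^ n * ?c)"
    using \<eta> by (simp add: exp_minus field_simps)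
  also have "\<dots> * (2 * ?J) = ennreal (2 * exp s / \<eta> ^ n) * (ennreal ?c * ?J)"
  proof -
    have "ennreal (2 * exp s / \<eta> ^ n) = ennreal (2 * (exp s / \<eta> ^ n))" by simp
    also have "\<dots> = 2 * ennreal (exp s / \<eta> ^ n)" using \<eta> by (subst ennreal_mult) auto
    finally show ?thesis using \<eta> by (subst ennreal_mult) (auto simp: ac_simps)
  qed
  also have "\<dots> \<le> ennreal (2 * exp s / \<eta> ^ n) * laplace n law \<theta>"
    by (intro mult_left_mono laplace_lower_bound x' \<eta> s) auto
  finally show ?thesis .
qed

text \<open>
For a fixed anchor \<open>y\<close> in the level set, substitute \<open>x = (1 - \<eta>) x' + \<eta> y\<close>. By log-concavity the
density at \<open>x\<close> is at least \<open>exp (- s \<eta>)\<close> times the density at \<open>x'\<close>, so the law of \<open>x'\<close> is almost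
the law of \<open>x\<close>.
\<close>

lemma extrapolation_in_level:
  assumes y: "y \<in> level s" and \<eta>: "0 < \<eta>" "\<eta> < 1"
  shows "ennreal ((1 - \<eta>) ^ n * exp (- (s * \<eta>)) * measure law (level s))
     \<le> (\<integral>\<^sup>+x. ennreal (f x) * indicator (level s) (comb n (1 / (1 - \<eta>)) x y) \<partial>leb n)"
proof -
  have y': "y \<in> Rn n" "exp (- s) * peak \<le> f y" using y by (auto simp: level_def)
  note [measurable] = measurable_comb_left[OF y'(1)]
  let ?h = "\<lambda>x. ennreal (f x) * indicator (level s) (comb n (1 / (1 - \<eta>)) x y) :: ennreal"
  have "ennreal ((1 - \<eta>) ^ n * exp (- (s * \<eta>)) * measure law (level s))
      = ennreal ((1 - \<eta>) ^ n) * (ennreal (exp (- (s * \<eta>))) * emeasure law (level s))"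
    using \<eta> by (simp add: law.emeasure_eq_measure ennreal_mult mult.assoc)
  also have "emeasure law (level s) = (\<integral>\<^sup>+x. ennreal (f x) * indicator (level s) x \<partial>leb n)"
    by (simp add: law_def emeasure_density)
  finally have 1: "ennreal ((1 - \<eta>) ^ n * exp (- (s * \<eta>)) * measure law (level s))
      = ennreal ((1 - \<eta>) ^ n) * (ennreal (exp (- (s * \<eta>))) *
          (\<integral>\<^sup>+x. ennreal (f x) * indicator (level s) x \<partial>leb n))" .
  have "ennreal (exp (- (s * \<eta>))) * (\<integral>\<^sup>+x. ennreal (f x) * indicator (level s) x \<partial>leb n)
      = (\<integral>\<^sup>+x. ennreal (exp (- (s * \<eta>))) * (ennreal (f x) * indicator (level s) x) \<partial>leb n)"
    by (subst nn_integral_cmult) auto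
  also have "\<dots> \<le> (\<integral>\<^sup>+x. ?h (comb n (1 - \<eta>) x y) \<partial>leb n)"
  proof (rule nn_integral_mono)
    fix x :: "nat \<Rightarrow> real" assume "x \<in> space (leb n)"
    then have x: "x \<in> Rn n" by simp
    have inv: "comb n (1 / (1 - \<eta>)) (comb n (1 - \<eta>) x y) y = x"
      using \<eta> x by (simp add: comb_comb comb_one)
    have "exp (- (s * \<eta>)) * f x \<le> f (comb n (1 - \<eta>) x y)"
      using log_concave_level[OF x y'(1) _ _ y'(2), of "1 - \<eta>"] \<eta> by (simp add: mult.commute)
    then have "ennreal (exp (- (s * \<eta>))) * ennreal (f x) \<le> ennreal (f (comb n (1 - \<eta>) x y))"
      by (subst ennreal_mult'[symmetric]) (auto intro: ennreal_leI)
    then show "ennreal (exp (- (s * \<eta>))) * (ennreal (f x) * indicator (level s) x)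
        \<le> ?h (comb n (1 - \<eta>) x y)"
      unfolding inv by (cases "x \<in> level s") simp_all
  qed
  finally have 2: "ennreal (exp (- (s * \<eta>))) * (\<integral>\<^sup>+x. ennreal (f x) * indicator (level s) x \<partial>leb n)
      \<le> (\<integral>\<^sup>+x. ?h (comb n (1 - \<eta>) x y) \<partial>leb n)" .
  have 3: "(\<integral>\<^sup>+x. ?h x \<partial>leb n)
      = ennreal ((1 - \<eta>) ^ n) * (\<integral>\<^sup>+x. ?h (comb n (1 - \<eta>) x y) \<partial>leb n)"
    using \<eta> by (intro nn_integral_leb_comb) auto
  show ?thesis unfolding 1 3 by (intro mult_left_mono 2) simp
qed

lemma emeasure_anchors:
  assumes x: "x \<in> Rn n"
  shows "emeasure law (anchors \<eta> s x)
    = (\<integral>\<^sup>+y. ennreal (f y) * indicator (level s) (comb n (1 / (1 - \<eta>)) x y) \<partial>leb n)"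
  using anchors_sets[OF x, of \<eta> s] unfolding law_def
  by (subst emeasure_density) (auto simp: anchors_def indicator_def intro!: nn_integral_cong)

lemma measurable_emeasure_anchors:
  "(\<lambda>x. emeasure law (anchors \<eta> s x)) \<in> borel_measurable (leb n)"
proof -
  interpret L: sigma_finite_measure "leb n" by (rule sigma_finite_leb)
  have "(\<lambda>x. \<integral>\<^sup>+y. ennreal (f y) * indicator (level s) (comb n (1 / (1 - \<eta>)) x y) \<partial>leb n)
      \<in> borel_measurable (leb n)"
    by (intro L.borel_measurable_nn_integral) measurable
  then show ?thesis
    by (subst measurable_cong[OF emeasure_anchors]) auto
qed

text \<open>
Integrate \<open>extrapolation_in_level\<close> over the anchors and exchange the integrals: a typical point has
almost all points as anchors.
\<close>

lemma anchors_mass: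
  assumes \<eta>: "0 < \<eta>" "\<eta> < 1"
  shows "ennreal ((1 - \<eta>) ^ n * exp (- (s * \<eta>)) * (measure law (level s))\<^sup>2)
     \<le> (\<integral>\<^sup>+x. emeasure law (anchors \<eta> s x) \<partial>law)"
proof -
  interpret L: sigma_finite_measure "leb n" by (rule sigma_finite_leb)
  interpret LL: pair_sigma_finite "leb n" "leb n" ..
  let ?c = "(1 - \<eta>) ^ n * exp (- (s * \<eta>)) * measure law (level s)"
  let ?k = "\<lambda>x y. ennreal (f x) * (ennreal (f y) * indicator (level s) (comb n (1 / (1 - \<eta>)) x y)) :: ennreal"
  have "ennreal (?c * measure law (level s)) = ennreal ?c * emeasure law (level s)"
    using \<eta> by (simp add: law.emeasure_eq_measure ennreal_mult)
  also have "\<dots> = (\<integral>\<^sup>+y. ennreal ?c * (ennreal (f y) * indicator (level s) y) \<partial>leb n)"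
    by (subst nn_integral_cmult) (auto simp: law_def emeasure_density)
  also have "\<dots> \<le> (\<integral>\<^sup>+y. ennreal (f y) *
       (\<integral>\<^sup>+x. ennreal (f x) * indicator (level s) (comb n (1 / (1 - \<eta>)) x y) \<partial>leb n) \<partial>leb n)"
  proof (rule nn_integral_mono)
    fix y :: "nat \<Rightarrow> real"
    show "ennreal ?c * (ennreal (f y) * indicator (level s) y) \<le> ennreal (f y) *
       (\<integral>\<^sup>+x. ennreal (f x) * indicator (level s) (comb n (1 / (1 - \<eta>)) x y) \<partial>leb n)"
    proof (cases "y \<in> level s")
      case True
      then show ?thesis using extrapolation_in_level[OF True \<eta>]
        by (subst mult.commute) (simp add: mult_left_mono)
    qed simp
  qed
  also have "\<dots> = (\<integral>\<^sup>+y. (\<integral>\<^sup>+x. ?k x y \<partial>leb n) \<partial>leb n)"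
  proof (rule nn_integral_cong)
    fix y :: "nat \<Rightarrow> real" assume "y \<in> space (leb n)"
    then have [measurable]: "(\<lambda>x. comb n (1 / (1 - \<eta>)) x y) \<in> measurable (leb n) (leb n)"
      by (intro measurable_comb) auto
    show "ennreal (f y) *
       (\<integral>\<^sup>+x. ennreal (f x) * indicator (level s) (comb n (1 / (1 - \<eta>)) x y) \<partial>leb n)
      = (\<integral>\<^sup>+x. ?k x y \<partial>leb n)"
      by (subst nn_integral_cmult[symmetric]) (auto simp: ac_simps)
  qed
  also have "\<dots> = (\<integral>\<^sup>+x. (\<integral>\<^sup>+y. ?k x y \<partial>leb n) \<partial>leb n)"
    by (rule LL.Fubini') measurable
  also have "\<dots> = (\<integral>\<^sup>+x. ennreal (f x) * emeasure law (anchors \<eta> s x) \<partial>leb n)"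
  proof (rule nn_integral_cong)
    fix x :: "nat \<Rightarrow> real" assume "x \<in> space (leb n)"
    then have x: "x \<in> Rn n" by simp
    then have [measurable]: "(\<lambda>y. comb n (1 / (1 - \<eta>)) x y) \<in> measurable (leb n) (leb n)"
      by (intro measurable_comb) auto
    show "(\<integral>\<^sup>+y. ?k x y \<partial>leb n) = ennreal (f x) * emeasure law (anchors \<eta> s x)"
      unfolding emeasure_anchors[OF x] by (subst nn_integral_cmult) auto
  qed
  also have "\<dots> = (\<integral>\<^sup>+x. emeasure law (anchors \<eta> s x) \<partial>law)"
    by (rule nn_integral_law[symmetric]) (rule measurable_emeasure_anchors)
  finally show ?thesis by (simp add: power2_eq_square mult.assoc)
qed

text \<open>
A point of the excess set has at most half of all points as anchors, so Markov's inequality applied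
to the mass of the non-anchors bounds the excess set.
\<close>

lemma excess_mass:
  assumes \<eta>: "0 < \<eta>" "\<eta> < 1" and s: "0 \<le> s"
    and T: "2 * exp s / \<eta> ^ n \<le> exp T"
  shows "measure law (excess n law T)
     \<le> 2 * (1 - (1 - \<eta>) ^ n * exp (- (s * \<eta>)) * (measure law (level s))\<^sup>2)"
proof -
  let ?c = "(1 - \<eta>) ^ n * exp (- (s * \<eta>)) * (measure law (level s))\<^sup>2"
  let ?g = "\<lambda>x. emeasure law (anchors \<eta> s x)"
  let ?E = "excess n law T"
  have E[measurable]: "?E \<in> sets (leb n)" by (rule excess_sets)
  have small: "measure law (anchors \<eta> s x) \<le> 1 / 2" if x: "x \<in> ?E" for x
  proof (rule ccontr)
    assume "\<not> ?thesis"
    then have g: "measure law (anchors \<eta> s x) > 1 / 2" by simp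
    obtain \<theta> where \<theta>: "ennreal (exp T) * laplace n law \<theta> < ennreal (exp (dot n \<theta> x))"
      using x by (auto simp: excess_def)
    have "ennreal (exp (dot n \<theta> x)) \<le> ennreal (2 * exp s / \<eta> ^ n) * laplace n law \<theta>"
      using x excess_subset by (intro exp_le_laplace_if_anchors g \<eta> s) blast
    also have "\<dots> \<le> ennreal (exp T) * laplace n law \<theta>"
      by (intro mult_right_mono ennreal_leI T) simp
    finally show False using \<theta> by simp
  qed
  have "ennreal ?c \<le> (\<integral>\<^sup>+x. ?g x \<partial>law)" by (rule anchors_mass[OF \<eta>])
  also have "\<dots> \<le> (\<integral>\<^sup>+x. ennreal (1 - indicator ?E x / 2) \<partial>law)"
    using small by (intro nn_integral_mono)
      (auto simp: indicator_def law.emeasure_eq_measure intro!: ennreal_leI)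
  also have "\<dots> = ennreal (\<integral>x. 1 - indicator ?E x / 2 \<partial>law)"
    by (intro nn_integral_eq_integral law.integrable_const_bound[where B = 1]) (auto simp: indicator_def)
  also have "(\<integral>x. 1 - indicator ?E x / 2 \<partial>law) = 1 - measure law ?E / 2"
    using E excess_subset[of n law T] law.prob_space
    by (subst Bochner_Integration.integral_diff)
      (auto simp: law.emeasure_eq_measure Int_absorb2 intro!: integrable_divide integrable_real_indicator)
  finally have "?c \<le> 1 - measure law ?E / 2"
    using order.trans[OF law.prob_le_1[of ?E], of 2] by (subst (asm) ennreal_le_iff) simp_all
  then show ?thesis by simp
qed

text \<open>
The parameter \<open>s\<close> makes the complement of the level set have mass at most \<open>e = exp (- w)\<close>, and
\<open>\<eta>\<close> is then chosen with \<open>(n + s) * \<eta> = e\<close>, so that the three factors in \<open>excess_mass\<close> lose \<open>3 * e\<close>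
altogether. The term \<open>n * ln (1 / \<eta>)\<close> in the height is what produces \<open>n * ln n\<close>.
\<close>

lemma excess_mass_le_exp:
  assumes n: "n \<ge> 1" and w: "w \<ge> 0"
  shows "measure law (excess n law (real n * ln (real n) + 5 * real n * (1 + w))) \<le> 6 * exp (- w)"
proof -
  define s where "s = 2 * (real n * ln 2 + w)"
  define \<eta> where "\<eta> = exp (- (w + ln (real n + s)))"
  define e where "e = exp (- w)"
  have ln2: "0 < ln (2::real)" "ln (2::real) \<le> 1" using ln_le_minus_one[of "2::real"] by auto
  have n1: "real n \<ge> 1" using n by simp
  have "real n * ln 2 > 0" using n1 ln2 by simp
  then have s: "s > 0" using w by (simp add: s_def add_pos_nonneg)
  have ns: "real n + s > 1" using n1 s by linarith
  have e01: "0 < e" "e \<le> 1" using w by (auto simp: e_def)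
  have \<eta>e: "(real n + s) * \<eta> = e"
  proof -
    have "\<eta> = exp (- w - ln (real n + s))" by (simp add: \<eta>_def)
    also have "\<dots> = e / (real n + s)" using ns by (simp only: exp_diff e_def) simp
    finally show ?thesis using ns by simp
  qed
  have "ln (real n + s) > 0" using ns by simp
  then have \<eta>01: "0 < \<eta>" "\<eta> < 1" using w by (auto simp: \<eta>_def)
  define p where "p = measure law (level s)"
  have "2 ^ n * exp (- s / 2) = e"
  proof -
    have "exp (- s / 2) = exp (- (real n * ln 2)) * e"
      unfolding e_def exp_add[symmetric] by (simp add: s_def field_simps)
    also have "exp (- (real n * ln 2)) = 1 / 2 ^ n"
      by (simp add: exp_minus exp_of_nat_mult inverse_eq_divide)
    finally show ?thesis by simp
  qed
  then have p: "1 - e \<le> p" using level_mass[of s] by (simp add: p_def)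
  have p2: "(1 - e)\<^sup>2 \<le> p\<^sup>2" using p e01 by (intro power_mono) auto
  have ne: "real n * \<eta> \<le> e" "s * \<eta> \<le> e"
  proof -
    have "0 \<le> real n * \<eta>" "0 \<le> s * \<eta>" using \<eta>01 s by simp_all
    then show "real n * \<eta> \<le> e" "s * \<eta> \<le> e"
      using \<eta>e unfolding distrib_right by linarith+
  qed
  have "1 - e \<le> (1 - real n * \<eta>) * (1 - s * \<eta>)"
    using \<eta>e \<eta>01 s by (simp add: algebra_simps)
  also have "\<dots> \<le> (1 - \<eta>) ^ n * exp (- (s * \<eta>))"
  proof (intro mult_mono)
    show "1 - real n * \<eta> \<le> (1 - \<eta>) ^ n"
      using Bernoulli_inequality[of "- \<eta>" n] \<eta>01 by simp
    show "1 - s * \<eta> \<le> exp (- (s * \<eta>))"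
      using exp_ge_add_one_self[of "- (s * \<eta>)"] by simp
  qed (use ne e01 \<eta>01 in auto)
  finally have "(1 - e) * (1 - e)\<^sup>2 \<le> (1 - \<eta>) ^ n * exp (- (s * \<eta>)) * p\<^sup>2"
    using p2 \<eta>01 e01 by (intro mult_mono) auto
  moreover have "1 - 3 * e \<le> (1 - e) * (1 - e)\<^sup>2"
  proof -
    have "(1 - e) * (1 - e)\<^sup>2 - (1 - 3 * e) = e\<^sup>2 * (3 - e)"
      by (simp add: power2_eq_square algebra_simps)
    moreover have "\<dots> \<ge> 0" using e01 by simp
    ultimately show ?thesis by linarith
  qed
  ultimately have c: "1 - 3 * e \<le> (1 - \<eta>) ^ n * exp (- (s * \<eta>)) * p\<^sup>2" by linarith
  let ?T = "real n * ln (real n) + 5 * real n * (1 + w)"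
  have nw: "w \<le> real n * w" using n1 w by (simp add: mult_le_cancel_right1)
  have "real n + s \<le> real n * (3 + 2 * w)"
  proof -
    have "real n * ln 2 \<le> real n" using n1 ln2 by (simp add: mult_left_le)
    then show ?thesis using nw by (simp add: s_def algebra_simps)
  qed
  then have "ln (real n + s) \<le> ln (real n * (3 + 2 * w))"
    using ns by simp
  also have "\<dots> = ln (real n) + ln (3 + 2 * w)"
    using n1 w by (intro ln_mult_pos) auto
  also have "ln (3 + 2 * w) \<le> 2 + 2 * w"
    using ln_le_minus_one[of "3 + 2 * w"] w by simp
  finally have "real n * (w + ln (real n + s)) \<le> real n * (w + (ln (real n) + (2 + 2 * w)))"
    using n1 by (intro mult_left_mono) auto
  moreover have "s \<le> 2 * real n + 2 * (real n * w)"
  proof -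
    have "real n * ln 2 \<le> real n" using n1 ln2 by (simp add: mult_left_le)
    then show ?thesis using nw by (simp add: s_def)
  qed
  ultimately have "ln 2 + s + real n * (w + ln (real n + s)) \<le> ?T"
    using ln2 n1 by (simp add: algebra_simps)
  moreover have "2 * exp s / \<eta> ^ n = exp (ln 2 + s + real n * (w + ln (real n + s)))"
  proof -
    have "\<eta> ^ n = exp (- (real n * (w + ln (real n + s))))"
      by (simp add: \<eta>_def exp_of_nat_mult[symmetric] algebra_simps)
    then show ?thesis
      by (simp only: exp_add exp_minus) (simp add: divide_inverse)
  qed
  ultimately have "2 * exp s / \<eta> ^ n \<le> exp ?T" by simp
  from excess_mass[OF \<eta>01 less_imp_le[OF s] this] c
  show ?thesis by (simp add: p_def e_def)
qed

end

section \<open>Contraction towards the mean\<close>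

context log_concave_density
begin

definition mean :: "nat \<Rightarrow> real" where
  "mean = (\<lambda>i\<in>{..<n}. \<integral>x. x i \<partial>law)"

lemma mean_in_Rn [simp]: "mean \<in> Rn n"
  by (simp add: mean_def)

lemma AE_law: "AE x in law. x \<in> Rn n \<and> f x > 0"
proof -
  have "AE x in law. f x > 0"
    unfolding law_def using f_nonneg by (subst AE_density) (auto simp: ennreal_less_zero_iff)
  moreover have "AE x in law. x \<in> Rn n" using AE_space[of law] by simp
  ultimately show ?thesis by auto
qed

lemma AE_law_cube: "\<exists>R\<ge>0. AE x in law. x \<in> cube n R"
proof -
  obtain R where R: "\<And>x. x \<in> Rn n \<Longrightarrow> f x \<noteq> 0 \<Longrightarrow> x \<in> cube n R"
    using f_support by blast
  have "AE x in law. x \<in> cube n \<bar>R\<bar>"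
    using AE_law
  proof eventually_elim
    case (elim x)
    then have "x \<in> cube n R" using R[of x] by auto
    then show ?case by (force simp: cube_iff)
  qed
  then show ?thesis by (intro exI[of _ "\<bar>R\<bar>"]) auto
qed

lemma measurable_coordinate: "i < n \<Longrightarrow> (\<lambda>x. x i) \<in> borel_measurable law"
  using measurable_component_singleton[of i "{..<n}" "\<lambda>_. lborel :: real measure"]
  by (simp add: law_def)

lemma integrable_coordinate: "i < n \<Longrightarrow> integrable law (\<lambda>x. x i)"
proof -
  assume i: "i < n"
  obtain R where "AE x in law. x \<in> cube n R" using AE_law_cube by blast
  then have "AE x in law. norm (x i) \<le> R"
    by eventually_elim (use i in \<open>auto simp: cube_iff\<close>)
  then show ?thesis
    by (intro law.integrable_const_bound measurable_coordinate i)
qed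

lemma integrable_dot: "integrable law (dot n \<theta>)"
  unfolding dot_def by (intro Bochner_Integration.integrable_sum integrable_mult_right integrable_coordinate) auto

lemma integral_dot: "(\<integral>x. dot n \<theta> x \<partial>law) = dot n \<theta> mean"
  unfolding dot_def
  by (subst Bochner_Integration.integral_sum)
    (auto intro!: integrable_mult_right integrable_coordinate sum.cong simp: mean_def)

lemma integrable_exp_dot: "integrable law (\<lambda>x. exp (dot n \<theta> x))"
proof -
  obtain R where R: "R \<ge> 0" "AE x in law. x \<in> cube n R" using AE_law_cube by blast
  from R(2) have "AE x in law. norm (exp (dot n \<theta> x)) \<le> exp (\<Sum>i<n. \<bar>\<theta> i\<bar> * R)"
  proof eventually_elim
    case (elim x)
    have "dot n \<theta> x \<le> (\<Sum>i<n. \<bar>\<theta> i\<bar> * R)"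
      unfolding dot_def
    proof (rule sum_mono)
      fix i assume "i \<in> {..<n}"
      then have "\<bar>x i\<bar> \<le> R" using elim by (auto simp: cube_iff)
      then have "\<bar>\<theta> i\<bar> * \<bar>x i\<bar> \<le> \<bar>\<theta> i\<bar> * R" by (intro mult_left_mono) auto
      then show "\<theta> i * x i \<le> \<bar>\<theta> i\<bar> * R" by (metis abs_mult abs_le_D1)
    qed
    then show ?case by simp
  qed
  moreover have "(\<lambda>x. exp (dot n \<theta> x)) \<in> borel_measurable law" by measurable
  ultimately show ?thesis by (intro law.integrable_const_bound)
qed

lemma laplace_law: "laplace n law \<theta> = ennreal (\<integral>x. exp (dot n \<theta> x) \<partial>law)"
  unfolding laplace_def by (intro nn_integral_eq_integral integrable_exp_dot) auto

text \<open>
Jensen's inequality for \<open>exp\<close>: the Cramer transform vanishes at the mean.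
\<close>

lemma exp_dot_mean_le: "exp (dot n \<theta> mean) \<le> (\<integral>x. exp (dot n \<theta> x) \<partial>law)"
proof -
  have "exp (dot n \<theta> mean) = (\<integral>x. exp (dot n \<theta> mean) * (1 + (dot n \<theta> x - dot n \<theta> mean)) \<partial>law)"
    using integrable_dot[of \<theta>] law.prob_space
    by (simp add: integral_dot)
  also have "\<dots> \<le> (\<integral>x. exp (dot n \<theta> x) \<partial>law)"
  proof (rule integral_mono)
    show "integrable law (\<lambda>x. exp (dot n \<theta> mean) * (1 + (dot n \<theta> x - dot n \<theta> mean)))"
      using integrable_dot[of \<theta>] by simp
    fix x
    have "exp (dot n \<theta> mean) * (1 + (dot n \<theta> x - dot n \<theta> mean))
        \<le> exp (dot n \<theta> mean) * exp (dot n \<theta> x - dot n \<theta> mean)"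
      by (intro mult_left_mono exp_ge_add_one_self) auto
    then show "exp (dot n \<theta> mean) * (1 + (dot n \<theta> x - dot n \<theta> mean)) \<le> exp (dot n \<theta> x)"
      by (simp add: exp_add[symmetric])
  qed (rule integrable_exp_dot)
  finally show ?thesis .
qed

text \<open>
The Cramer transform is convex and vanishes at the mean, so contracting towards the mean by the
factor \<open>l\<close> multiplies its value by at most \<open>l\<close>.
\<close>

lemma not_excess_contract:
  assumes x: "x \<in> Rn n" "x \<notin> excess n law T" and l: "0 < l" "l < 1"
  shows "comb n l x mean \<notin> excess n law (l * T)"
proof
  assume "comb n l x mean \<in> excess n law (l * T)"
  then obtain \<theta> where \<theta>: "\<theta> \<in> Rn n"
    "ennreal (exp (l * T)) * laplace n law \<theta> < ennreal (exp (dot n \<theta> (comb n l x mean)))"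
    by (auto simp: excess_def)
  define I where "I = (\<integral>x. exp (dot n \<theta> x) \<partial>law)"
  have I: "laplace n law \<theta> = ennreal I" by (simp add: I_def laplace_law)
  have I0: "I > 0" using exp_dot_mean_le[of \<theta>] exp_gt_zero[of "dot n \<theta> mean"]
    unfolding I_def by linarith
  have eI: "exp (ln I) = I" using I0 by simp
  have "exp (l * T + ln I) < exp (dot n \<theta> (comb n l x mean))"
    using \<theta>(2) I0 unfolding I by (simp add: ennreal_mult[symmetric] ennreal_less_iff exp_add)
  then have "l * T + ln I < l * dot n \<theta> x + (1 - l) * dot n \<theta> mean"
    by (simp add: dot_comb)
  moreover have "dot n \<theta> x \<le> T + ln I"
  proof -
    have "ennreal (exp (dot n \<theta> x)) \<le> ennreal (exp T) * laplace n law \<theta>"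
      using x \<theta>(1) by (auto simp: excess_def not_less)
    then have "exp (dot n \<theta> x) \<le> exp (T + ln I)"
      using I0 unfolding I by (simp add: ennreal_mult[symmetric] exp_add)
    then show ?thesis by simp
  qed
  then have "l * dot n \<theta> x \<le> l * (T + ln I)" using l by (intro mult_left_mono) auto
  moreover have "dot n \<theta> mean \<le> ln I"
    using exp_dot_mean_le[of \<theta>] eI unfolding I_def[symmetric] by (metis exp_le_cancel_iff)
  then have "(1 - l) * dot n \<theta> mean \<le> (1 - l) * ln I" using l by (intro mult_left_mono) auto
  ultimately show False by (simp add: algebra_simps)
qed

text \<open>
The contraction has Jacobian \<open>l ^ n\<close>, and the density at a contracted point is at least
\<open>exp (- s)\<close> times the density at the original one. This controls the mass of the set where the
Cramer transform is small, down to height zero.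
\<close>

lemma excess_mass_contract:
  assumes b: "exp (- s) * peak \<le> f mean" and s: "0 \<le> s" and l: "0 < l" "l < 1"
  shows "measure law (excess n law (l * T))
      \<le> 1 - l ^ n * exp (- s) * (1 - measure law (excess n law T))"
proof -
  let ?K = "\<lambda>T. Rn n - excess n law T"
  have K[measurable]: "?K T \<in> sets (leb n)" for T
    using sets.compl_sets[OF excess_sets] by simp
  have compl: "measure law (?K T) = 1 - measure law (excess n law T)" for T
    using law.prob_compl[of "excess n law T"] excess_sets by simp
  note [measurable] = measurable_comb_left[OF mean_in_Rn]
  let ?h = "\<lambda>x. ennreal (f x) * indicator (?K (l * T)) x :: ennreal"
  have em: "emeasure law (?K T) = (\<integral>\<^sup>+x. ennreal (f x) * indicator (?K T) x \<partial>leb n)" for T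
    using K by (simp add: law_def emeasure_density)
  have "ennreal (exp (- s)) * emeasure law (?K T)
      = (\<integral>\<^sup>+x. ennreal (exp (- s)) * (ennreal (f x) * indicator (?K T) x) \<partial>leb n)"
    unfolding em by (subst nn_integral_cmult) auto
  also have "\<dots> \<le> (\<integral>\<^sup>+x. ?h (comb n l x mean) \<partial>leb n)"
  proof (rule nn_integral_mono)
    fix x :: "nat \<Rightarrow> real" assume "x \<in> space (leb n)"
    then have x: "x \<in> Rn n" by simp
    have "exp (- s) * f x \<le> f x * exp (- (s * (1 - l)))"
      using l s f_nonneg[of x] by (subst mult.commute, intro mult_left_mono) (auto simp: mult_left_le)
    also have "\<dots> \<le> f (comb n l x mean)"
      by (rule log_concave_level[OF x mean_in_Rn l b])
    finally have "ennreal (exp (- s)) * ennreal (f x) \<le> ennreal (f (comb n l x mean))"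
      by (subst ennreal_mult'[symmetric]) (auto intro: ennreal_leI)
    then show "ennreal (exp (- s)) * (ennreal (f x) * indicator (?K T) x)
        \<le> ?h (comb n l x mean)"
      using not_excess_contract[OF x _ l, of T] by (cases "x \<in> ?K T") simp_all
  qed
  finally have 1: "ennreal (exp (- s)) * emeasure law (?K T) \<le> (\<integral>\<^sup>+x. ?h (comb n l x mean) \<partial>leb n)" .
  have "ennreal (l ^ n * exp (- s) * measure law (?K T))
      = ennreal (l ^ n) * (ennreal (exp (- s)) * emeasure law (?K T))"
    using l by (simp add: law.emeasure_eq_measure ennreal_mult mult.assoc)
  also have "\<dots> \<le> ennreal (l ^ n) * (\<integral>\<^sup>+x. ?h (comb n l x mean) \<partial>leb n)"
    by (intro mult_left_mono 1) simp
  also have "\<dots> = (\<integral>\<^sup>+x. ?h x \<partial>leb n)"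
    using l by (intro nn_integral_leb_comb[symmetric]) auto
  also have "\<dots> = ennreal (measure law (?K (l * T)))"
    by (simp add: em[symmetric] law.emeasure_eq_measure)
  finally have "l ^ n * exp (- s) * measure law (?K T) \<le> measure law (?K (l * T))"
    by (simp add: ennreal_le_iff)
  then show ?thesis by (simp add: compl)
qed

end

section \<open>The density at the mean in dimension one\<close>

text \<open>
In dimension one this is the inverse of the coordinate map, so that \<open>f \<circ> diag n\<close> is the
density as a function on the line.
\<close>

definition diag :: "nat \<Rightarrow> real \<Rightarrow> nat \<Rightarrow> real" where
  "diag n t = (\<lambda>i\<in>{..<n}. t)"

lemma diag_in_Rn [simp]: "diag n t \<in> Rn n"
  by (simp add: diag_def)

lemma comb_diag: "comb n l (diag n s) (diag n t) = diag n (l * s + (1 - l) * t)"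
  by (auto simp: comb_def diag_def fun_eq_iff)

lemma diag_coordinate: "n = 1 \<Longrightarrow> x \<in> Rn n \<Longrightarrow> diag n (x 0) = x"
  by (auto simp: diag_def fun_eq_iff PiE_iff extensional_def)

context log_concave_density
begin

lemma AE_f_diag: "n = 1 \<Longrightarrow> AE x in law. f (diag n (x 0)) = f x"
  using AE_law by eventually_elim (metis diag_coordinate)

text \<open>
The entropy bound \<open>E (ln (peak / f)) \<le> 2\<close> follows from \<open>ln t \<le> 2 * (sqrt t - 1)\<close> and the bound
\<open>sqrt_density_integral\<close>, which says \<open>E (sqrt (peak / f)) \<le> 2\<close> for \<open>n = 1\<close>.
\<close>

lemma log_density_integral:
  assumes n: "n = 1"
  shows "integrable law (\<lambda>x. - ln (f (diag n (x 0))))"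
    and "(\<integral>x. - ln (f (diag n (x 0))) \<partial>law) \<le> 2 - ln peak"
proof -
  let ?h = "\<lambda>x. sqrt (peak / f x)"
  have h0: "?h x \<ge> 0" for x using peak_pos f_nonneg[of x] by simp
  have "(\<integral>\<^sup>+x. ennreal (?h x) \<partial>law) = (\<integral>\<^sup>+x. ennreal (f x) * ennreal (?h x) \<partial>leb n)"
    by (rule nn_integral_law) measurable
  also have "\<dots> = (\<integral>\<^sup>+x. ennreal (sqrt peak) * ennreal (sqrt (f x)) \<partial>leb n)"
  proof (rule nn_integral_cong)
    fix x
    have "f x * ?h x = sqrt peak * sqrt (f x)"
    proof (cases "f x = 0")
      case False
      then have "f x = sqrt (f x) * sqrt (f x)" "sqrt (f x) \<noteq> 0" using f_nonneg[of x] by auto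
      then show ?thesis by (simp add: real_sqrt_divide field_simps)
    qed simp
    then show "ennreal (f x) * ennreal (?h x) = ennreal (sqrt peak) * ennreal (sqrt (f x))"
      using f_nonneg peak_pos by (simp add: ennreal_mult'[symmetric])
  qed
  also have "\<dots> = ennreal (sqrt peak) * (\<integral>\<^sup>+x. ennreal (sqrt (f x)) \<partial>leb n)"
    by (rule nn_integral_cmult) measurable
  also have "\<dots> \<le> ennreal 2"
    using sqrt_density_integral n by simp
  finally have H: "(\<integral>\<^sup>+x. ennreal (?h x) \<partial>law) \<le> ennreal 2" .
  have int_h: "integrable law ?h"
    using le_less_trans[OF H] h0 by (intro integrableI_nonneg) auto
  have "ennreal (\<integral>x. ?h x \<partial>law) \<le> ennreal 2"
    using H h0 by (subst nn_integral_eq_integral[OF int_h, symmetric]) auto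
  then have int_le: "(\<integral>x. ?h x \<partial>law) \<le> 2" by (subst (asm) ennreal_le_iff) auto
  let ?q = "\<lambda>x. - ln (f x)"
  have bounds: "AE x in law. - ln peak \<le> ?q x \<and> ?q x \<le> - ln peak + 2 * (?h x - 1)"
    using AE_law
  proof eventually_elim
    case (elim x)
    then have fx: "0 < f x" "f x \<le> peak" using f_le_peak by auto
    have "2 * ln (?h x) = ln (peak / f x)"
      using fx by (simp add: ln_sqrt)
    also have "\<dots> = ln peak - ln (f x)" using fx by (simp add: ln_div)
    finally have 1: "ln peak - ln (f x) = 2 * ln (?h x)" by simp
    have 2: "ln (?h x) \<le> ?h x - 1" using fx by (intro ln_le_minus_one) auto
    have 3: "ln (f x) \<le> ln peak" using fx by simp
    have "- p \<le> - q \<and> - q \<le> - p + 2 * (h - 1)"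
      if "p - q = 2 * k" "k \<le> h - 1" "q \<le> p" for p q k h :: real
      using that by simp
    from this[OF 1 2 3] show ?case .
  qed
  have int_q: "integrable law ?q"
  proof (rule Bochner_Integration.integrable_bound)
    show "integrable law (\<lambda>x. \<bar>ln peak\<bar> + 2 * (?h x + 1))" using int_h by simp
    show "AE x in law. norm (?q x) \<le> norm (\<bar>ln peak\<bar> + 2 * (?h x + 1))"
      using bounds
    proof eventually_elim
      case (elim x)
      have "\<bar>- q\<bar> \<le> \<bar>p\<bar> + 2 * (h + 1)"
        if "- p \<le> - q \<and> - q \<le> - p + 2 * (h - 1)" "0 \<le> h" for p q h :: real
        using that by (auto simp: abs_if)
      from this[OF elim h0] have "\<bar>?q x\<bar> \<le> \<bar>ln peak\<bar> + 2 * (?h x + 1)" .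
      also have "\<dots> \<le> \<bar>\<bar>ln peak\<bar> + 2 * (?h x + 1)\<bar>" by (rule abs_ge_self)
      finally show ?case by (simp only: real_norm_def)
    qed
  qed measurable
  have eq: "AE x in law. - ln (f (diag n (x 0))) = ?q x"
    using AE_f_diag[OF n] by eventually_elim simp
  have [measurable]: "(\<lambda>x. diag n (x 0)) \<in> measurable law (leb n)"
    unfolding diag_def using measurable_coordinate[of 0] n by (intro measurable_restrict) auto
  have meas: "(\<lambda>x. - ln (f (diag n (x 0)))) \<in> borel_measurable law" by measurable
  show "integrable law (\<lambda>x. - ln (f (diag n (x 0))))"
    using int_q by (subst integrable_cong_AE[OF meas _ eq]) auto
  have "(\<integral>x. - ln (f (diag n (x 0))) \<partial>law) = (\<integral>x. ?q x \<partial>law)"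
    using meas eq by (intro integral_cong_AE) auto
  also have "\<dots> \<le> (\<integral>x. - ln peak + 2 * (?h x - 1) \<partial>law)"
    using int_q int_h bounds by (intro integral_mono_AE) auto
  also have "\<dots> = - ln peak + 2 * ((\<integral>x. ?h x \<partial>law) - 1)"
    using int_h law.prob_space by simp
  also have "\<dots> \<le> 2 - ln peak" using int_le by simp
  finally show "(\<integral>x. - ln (f (diag n (x 0))) \<partial>law) \<le> 2 - ln peak" .
qed

text \<open>
Jensen's inequality for the convex function \<open>- ln f\<close> on the interior of the support, combined with
the entropy bound.
\<close>

lemma density_at_mean:
  assumes n: "n = 1"
  shows "exp (- 2) * peak \<le> f mean"
proof -
  \<comment> \<open>The endpoints of the support interval are null, so the mean and almost all points lie in its interior.\<close>
  define S where "S = {t. f (diag n t) > 0}"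
  define a b where "a = Inf S" and "b = Sup S"
  define q where "q = (\<lambda>t. - ln (f (diag n t)))"
  have conv: "f (diag n s) powr l * f (diag n t) powr (1 - l) \<le> f (diag n (l * s + (1 - l) * t))"
    if "0 < l" "l < 1" for l s t
    using f_log_concave[OF diag_in_Rn diag_in_Rn that] by (simp add: comb_diag)
  obtain R where R: "\<And>x. x \<in> Rn n \<Longrightarrow> f x \<noteq> 0 \<Longrightarrow> x \<in> cube n R" using f_support by blast
  have SR: "S \<subseteq> {-R..R}"
  proof
    fix t assume "t \<in> S"
    then have "diag n t \<in> cube n R" using R[of "diag n t"] by (auto simp: S_def)
    then show "t \<in> {-R..R}" using n by (auto simp: cube_iff diag_def abs_le_iff)
  qed
  then have bdd: "bdd_above S" "bdd_below S"
    by (auto intro: bdd_above_mono bdd_below_mono)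
  have betw: "f (diag n u) > 0" if st: "s \<in> S" "t \<in> S" "s < u" "u < t" for s t u
  proof -
    define l where "l = (t - u) / (t - s)"
    have l: "0 < l" "l < 1" using st by (auto simp: l_def)
    have "l * (t - s) = t - u" using st by (simp add: l_def)
    then have u: "l * s + (1 - l) * t = u" by (simp add: algebra_simps)
    have "0 < f (diag n s) powr l * f (diag n t) powr (1 - l)" using st by (simp add: S_def)
    then show ?thesis using conv[OF l, of s t] by (simp add: u)
  qed
  have IS: "{a<..<b} \<subseteq> S"
  proof
    fix u assume u: "u \<in> {a<..<b}"
    have "S \<noteq> {}"
    proof
      assume "S = {}"
      have "AE x in law. x 0 \<in> S"
        using AE_law by eventually_elim (use n in \<open>auto simp: S_def diag_coordinate\<close>)
      then show False using \<open>S = {}\<close> by simp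
    qed
    then have "\<exists>s\<in>S. s < u" "\<exists>t\<in>S. u < t"
      using u cInf_lessD[of S u] less_cSupD[of S u] by (simp_all add: a_def b_def)
    then obtain s t where "s \<in> S" "s < u" "t \<in> S" "u < t" by blast
    then show "u \<in> S" using betw[of s t u] unfolding S_def by simp
  qed
  have "AE x in leb n. x 0 \<noteq> a" "AE x in leb n. x 0 \<noteq> b"
    using n by (auto intro: leb_coordinate_null)
  then have "AE x in law. x 0 \<noteq> a \<and> x 0 \<noteq> b"
    unfolding law_def by (subst AE_density) auto
  with AE_law have AE_I: "AE x in law. x 0 \<in> {a<..<b}"
  proof eventually_elim
    case (elim x)
    then have "x 0 \<in> S" using n by (auto simp: S_def diag_coordinate)
    then have "a \<le> x 0" "x 0 \<le> b" unfolding a_def b_def using bdd by (auto intro: cInf_lower cSup_upper)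
    then show ?case using elim by auto
  qed
  have int0: "integrable law (\<lambda>x. x 0)" using n by (intro integrable_coordinate) simp
  have cq: "convex_on {a<..<b} q"
  proof (rule convex_onI)
    fix l x y assume l: "0 < l" "l < (1::real)" and xy: "x \<in> {a<..<b}" "y \<in> {a<..<b}"
    then have pos: "f (diag n x) > 0" "f (diag n y) > 0" using IS by (auto simp: S_def)
    have "ln (f (diag n x) powr (1 - l) * f (diag n y) powr l) \<le> ln (f (diag n ((1 - l) * x + l * y)))"
      using conv[of "1 - l" x y] l pos by (intro ln_mono) auto
    also have "ln (f (diag n x) powr (1 - l) * f (diag n y) powr l) = (1 - l) * ln (f (diag n x)) + l * ln (f (diag n y))"
      using pos by (simp add: ln_mult ln_powr)
    finally show "q ((1 - l) *\<^sub>R x + l *\<^sub>R y) \<le> (1 - l) * q x + l * q y"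
      by (simp add: q_def)
  qed simp
  have "q (\<integral>x. x 0 \<partial>law) \<le> (\<integral>x. q (x 0) \<partial>law)"
    using log_density_integral(1)[OF n]
    by (intro law.jensens_inequality[OF int0 AE_I _ _ cq]) (auto simp: q_def)
  also have "\<dots> \<le> 2 - ln peak"
    using log_density_integral(2)[OF n] by (simp add: q_def)
  finally have q: "q (\<integral>x. x 0 \<partial>law) \<le> 2 - ln peak" .
  have "(\<integral>x. x 0 \<partial>law) \<in> {a<..<b}"
    using AE_I by (auto intro!: law.expectation_less law.expectation_greater int0 elim: eventually_mono)
  then have pos: "f (diag n (\<integral>x. x 0 \<partial>law)) > 0" using IS by (auto simp: S_def)
  have m: "mean = diag n (\<integral>x. x 0 \<partial>law)"
    unfolding mean_def diag_def by (rule restrict_ext) (use n in simp)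
  have "exp (- 2) * peak = exp (- 2 + ln peak)" using peak_pos by (simp only: exp_add exp_ln)
  also have "\<dots> \<le> exp (ln (f mean))" using q by (simp add: q_def m)
  also have "\<dots> = f mean" using pos by (simp add: m)
  finally show ?thesis .
qed

lemma excess_mass_contract_1:
  assumes "n = 1" "0 < l" "l < 1"
  shows "measure law (excess n law (l * T)) \<le> 1 - l * exp (- 2) * (1 - measure law (excess n law T))"
  using excess_mass_contract[OF density_at_mean[OF assms(1)] _ assms(2,3), of T] assms(1) by simp

end

section \<open>Approximation of a log-concave measure by log-concave densities\<close>

text \<open>
The part of the cube of side \<open>2 * r\<close> around \<open>x\<close> that lies in the cube of side \<open>2 * k\<close> around the
origin. Windows are compact and their Minkowski combinations lie in windows, so the defining
inequality of a log-concave measure compares their masses.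
\<close>

definition window :: "nat \<Rightarrow> real \<Rightarrow> real \<Rightarrow> (nat \<Rightarrow> real) \<Rightarrow> (nat \<Rightarrow> real) set" where
  "window n k r x = (\<Pi>\<^sub>E i\<in>{..<n}. {max (- k) (x i - r)..min k (x i + r)})"

lemma window_iff: "z \<in> window n k r x \<longleftrightarrow> z \<in> cube n k \<and> (\<forall>i<n. \<bar>z i - x i\<bar> \<le> r)"
  by (auto simp: window_def cube_iff PiE_iff abs_le_iff minus_le_iff algebra_simps)

lemma compact_window: "compact_Rn n (window n k r x)"
  unfolding compact_Rn_def window_def by (subst compactin_PiE) auto

lemma window_sets: "window n k r x \<in> sets (leb n)"
  unfolding window_def by (intro sets_PiM_I_finite) auto

lemma mink_comb_window:
  assumes "0 < l" "l < 1"
  shows "mink_comb n l (window n k r x) (window n k r y) \<subseteq> window n k r (comb n l x y)"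
proof
  fix z assume "z \<in> mink_comb n l (window n k r x) (window n k r y)"
  then obtain u v where z: "z = comb n l u v" and u: "u \<in> window n k r x" and v: "v \<in> window n k r y"
    unfolding mink_comb_def comb_def[symmetric] by blast
  have conv: "\<bar>l * a + (1 - l) * b\<bar> \<le> c" if "\<bar>a\<bar> \<le> c" "\<bar>b\<bar> \<le> c" for a b c :: real
  proof -
    have "\<bar>l * a + (1 - l) * b\<bar> \<le> l * \<bar>a\<bar> + (1 - l) * \<bar>b\<bar>"
      using assms abs_triangle_ineq[of "l * a" "(1 - l) * b"] by (simp add: abs_mult)
    also have "\<dots> \<le> l * c + (1 - l) * c"
      using assms that by (intro add_mono mult_left_mono) auto
    finally show ?thesis by (simp add: algebra_simps)
  qed
  show "z \<in> window n k r (comb n l x y)"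
    unfolding window_iff cube_iff z
  proof (intro conjI allI impI)
    fix i assume i: "i < n"
    show "\<bar>comb n l u v i\<bar> \<le> k"
      using conv[of "u i" k "v i"] u v i by (simp add: comb_def window_iff cube_iff)
    have "comb n l u v i - comb n l x y i = l * (u i - x i) + (1 - l) * (v i - y i)"
      using i by (simp add: comb_def algebra_simps)
    then show "\<bar>comb n l u v i - comb n l x y i\<bar> \<le> r"
      using conv[of "u i - x i" r "v i - y i"] u v i by (simp add: window_iff)
  qed simp
qed

lemma measurable_shift:
  "(\<lambda>p. \<lambda>i\<in>{..<n}. fst p i + r * snd p i) \<in> measurable (leb n \<Otimes>\<^sub>M leb n) (leb n)"
proof (rule measurable_restrict)
  fix i assume i: "i \<in> {..<n}"
  have [measurable]: "(\<lambda>p. fst p i) \<in> borel_measurable (leb n \<Otimes>\<^sub>M leb n)"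
    "(\<lambda>p. snd p i) \<in> borel_measurable (leb n \<Otimes>\<^sub>M leb n)"
    using measurable_compose[OF measurable_fst measurable_component_singleton[OF i, of "\<lambda>_. lborel"]]
      measurable_compose[OF measurable_snd measurable_component_singleton[OF i, of "\<lambda>_. lborel"]]
    by auto
  show "(\<lambda>p. fst p i + r * snd p i) \<in> leb n \<Otimes>\<^sub>M leb n \<rightarrow>\<^sub>M lborel"
    unfolding measurable_lborel1 by measurable
qed

text \<open>
The density of \<open>X + r U\<close>, where \<open>X\<close> has the law \<open>\<mu>\<close> conditioned on \<open>cube n k\<close> and \<open>U\<close> is independent
and uniform on \<open>cube n 1\<close>.
\<close>

definition smooth :: "nat \<Rightarrow> (nat \<Rightarrow> real) measure \<Rightarrow> real \<Rightarrow> real \<Rightarrow> (nat \<Rightarrow> real) \<Rightarrow> real" where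
  "smooth n \<mu> k r x = measure \<mu> (window n k r x) / ((2 * r) ^ n * measure \<mu> (cube n k))"

locale log_concave_smoothing = prob_space \<mu>
  for n :: nat and \<mu> :: "(nat \<Rightarrow> real) measure" +
  fixes k r :: real
  assumes lc: "log_concave_prob n \<mu>"
    and r_pos: "r > 0"
    and mass_pos: "measure \<mu> (cube n k) > 0"
begin

lemma sets_\<mu> [measurable_cong]: "sets \<mu> = sets (leb n)"
  using lc by (simp add: log_concave_prob_def borel_prob_Rn_def sets_leb)

lemma space_\<mu>: "space \<mu> = Rn n"
  using sets_eq_imp_space_eq[OF sets_\<mu>] by simp

lemma window_events [measurable]: "window n k r x \<in> events"
  using window_sets sets_\<mu> by simp

lemma window_pair_sets:
  "{p \<in> space (leb n \<Otimes>\<^sub>M \<mu>). snd p \<in> window n k r (fst p)} \<in> sets (leb n \<Otimes>\<^sub>M \<mu>)"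
proof -
  have "{p \<in> space (leb n \<Otimes>\<^sub>M \<mu>). snd p \<in> window n k r (fst p)}
    = {p \<in> space (leb n \<Otimes>\<^sub>M \<mu>). snd p \<in> cube n k \<and> (\<forall>i\<in>{..<n}. \<bar>snd p i - fst p i\<bar> \<le> r)}"
    by (auto simp: window_iff)
  also have "\<dots> \<in> sets (leb n \<Otimes>\<^sub>M \<mu>)"
  proof -
    have [measurable]: "(\<lambda>p. fst p i) \<in> borel_measurable (leb n \<Otimes>\<^sub>M \<mu>)"
      "(\<lambda>p. snd p i) \<in> borel_measurable (leb n \<Otimes>\<^sub>M \<mu>)" if "i \<in> {..<n}" for i
      using that measurable_compose[OF measurable_fst measurable_component_singleton[OF that, of "\<lambda>_. lborel"]]
        measurable_compose[OF measurable_snd, of "\<lambda>x. x i" \<mu> borel "leb n"]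
        measurable_component_singleton[OF that, of "\<lambda>_. lborel :: real measure"]
        measurable_cong_sets[OF sets_\<mu> refl, of borel]
      by auto
    have [measurable]: "cube n k \<in> sets \<mu>" using cube_sets sets_\<mu> by simp
    show ?thesis by measurable
  qed
  finally show ?thesis .
qed

lemma measurable_window_indicator:
  "(\<lambda>(x, z). indicator (window n k r x) z :: ennreal) \<in> borel_measurable (leb n \<Otimes>\<^sub>M \<mu>)"
proof -
  have "indicator {p \<in> space (leb n \<Otimes>\<^sub>M \<mu>). snd p \<in> window n k r (fst p)}
      \<in> borel_measurable (leb n \<Otimes>\<^sub>M \<mu>)"
    using window_pair_sets by simp
  then show ?thesis
    by (rule measurable_cong[THEN iffD1, rotated]) (auto simp: indicator_def)
qed

lemma measurable_smooth: "smooth n \<mu> k r \<in> borel_measurable (leb n)"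
proof -
  have "(\<lambda>x. \<integral>\<^sup>+z. indicator (window n k r x) z \<partial>\<mu>) \<in> borel_measurable (leb n)"
    using measurable_window_indicator by (rule borel_measurable_nn_integral)
  then have [measurable]: "(\<lambda>x. emeasure \<mu> (window n k r x)) \<in> borel_measurable (leb n)"
    by simp
  show ?thesis unfolding smooth_def measure_def by measurable
qed

lemma smooth_nonneg: "0 \<le> smooth n \<mu> k r x"
  using r_pos by (simp add: smooth_def)

text \<open>
This is the description of \<open>smooth\<close> as the density of a sum: exchange the integrals and
substitute \<open>x = z + r u\<close>.
\<close>

lemma smooth_integral:
  assumes h [measurable]: "h \<in> borel_measurable (leb n)"
  shows "ennreal (2 ^ n * measure \<mu> (cube n k)) * (\<integral>\<^sup>+x. ennreal (smooth n \<mu> k r x) * h x \<partial>leb n)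
    = (\<integral>\<^sup>+z. indicator (cube n k) z * (\<integral>\<^sup>+u. h (\<lambda>i\<in>{..<n}. z i + r * u i) * indicator (cube n 1) u \<partial>leb n) \<partial>\<mu>)"
proof -
  interpret L: sigma_finite_measure "leb n" by (rule sigma_finite_leb)
  interpret LM: pair_sigma_finite "leb n" \<mu> ..
  note [measurable] = measurable_smooth
  let ?W = "\<lambda>x z. indicator (window n k r x) z :: ennreal"
  let ?m = "measure \<mu> (cube n k)"
  have meas: "(\<lambda>(x, z). h x * ?W x z) \<in> borel_measurable (leb n \<Otimes>\<^sub>M \<mu>)"
    using measurable_window_indicator by (simp add: case_prod_beta)
  have pt: "ennreal ((2 * r) ^ n * ?m) * (ennreal (smooth n \<mu> k r x) * h x) = (\<integral>\<^sup>+z. h x * ?W x z \<partial>\<mu>)" for x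
  proof -
    have "ennreal ((2 * r) ^ n * ?m) * ennreal (smooth n \<mu> k r x) = emeasure \<mu> (window n k r x)"
      using r_pos mass_pos by (simp add: ennreal_mult'[symmetric] smooth_def emeasure_eq_measure)
    then have "ennreal ((2 * r) ^ n * ?m) * (ennreal (smooth n \<mu> k r x) * h x) = h x * emeasure \<mu> (window n k r x)"
      by (metis mult.assoc mult.commute)
    then show ?thesis by (simp add: nn_integral_cmult)
  qed
  have inner: "(\<integral>\<^sup>+x. h x * ?W x z \<partial>leb n) = ennreal (r ^ n) *
      (indicator (cube n k) z * (\<integral>\<^sup>+u. h (\<lambda>i\<in>{..<n}. z i + r * u i) * indicator (cube n 1) u \<partial>leb n))"
    if z: "z \<in> space \<mu>" for z
  proof -
    have z': "z \<in> Rn n" using z space_\<mu> by simp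
    have "(\<lambda>x. h x * ?W x z) \<in> borel_measurable (leb n)"
      using measurable_Pair2'[OF z] meas measurable_compose[of "\<lambda>x. (x, z)" "leb n" "leb n \<Otimes>\<^sub>M \<mu>"] z
      by (auto simp: case_prod_beta dest: measurable_compose[OF measurable_Pair2'[OF z]])
    then have "(\<integral>\<^sup>+x. h x * ?W x z \<partial>leb n) = ennreal (r ^ n) *
       (\<integral>\<^sup>+u. h (\<lambda>i\<in>{..<n}. z i + r * u i) * ?W (\<lambda>i\<in>{..<n}. z i + r * u i) z \<partial>leb n)"
      by (intro nn_integral_leb_affine[OF r_pos])
    also have "(\<integral>\<^sup>+u. h (\<lambda>i\<in>{..<n}. z i + r * u i) * ?W (\<lambda>i\<in>{..<n}. z i + r * u i) z \<partial>leb n)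
      = (\<integral>\<^sup>+u. indicator (cube n k) z * (h (\<lambda>i\<in>{..<n}. z i + r * u i) * indicator (cube n 1) u) \<partial>leb n)"
    proof (rule nn_integral_cong)
      fix u :: "nat \<Rightarrow> real" assume "u \<in> space (leb n)"
      then have u: "u \<in> Rn n" by simp
      have "z \<in> window n k r (\<lambda>i\<in>{..<n}. z i + r * u i) \<longleftrightarrow> z \<in> cube n k \<and> u \<in> cube n 1"
      proof -
        have "\<bar>r * u i\<bar> \<le> r \<longleftrightarrow> \<bar>u i\<bar> \<le> 1" for i
          using r_pos by (simp add: abs_mult)
        then show ?thesis using u by (auto simp: window_iff cube_iff[of u])
      qed
      then show "h (\<lambda>i\<in>{..<n}. z i + r * u i) * ?W (\<lambda>i\<in>{..<n}. z i + r * u i) z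
        = indicator (cube n k) z * (h (\<lambda>i\<in>{..<n}. z i + r * u i) * indicator (cube n 1) u)"
        by (auto simp: indicator_def)
    qed
    also have "\<dots> = indicator (cube n k) z *
       (\<integral>\<^sup>+u. h (\<lambda>i\<in>{..<n}. z i + r * u i) * indicator (cube n 1) u \<partial>leb n)"
      using measurable_affine[where n = n and a = z and c = r]
      by (intro nn_integral_cmult) measurable
    finally show ?thesis .
  qed
  let ?I = "\<lambda>z. indicator (cube n k) z *
      (\<integral>\<^sup>+u. h (\<lambda>i\<in>{..<n}. z i + r * u i) * indicator (cube n 1) u \<partial>leb n)"
  have measI: "?I \<in> borel_measurable \<mu>"
  proof -
    have [measurable]: "(\<lambda>p. \<lambda>i\<in>{..<n}. fst p i + r * snd p i) \<in> measurable (\<mu> \<Otimes>\<^sub>M leb n) (leb n)"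
      using measurable_shift[where n = n and r = r] measurable_cong_sets[OF sets_pair_measure_cong[OF sets_\<mu> refl] refl]
      by blast
    have "(\<lambda>(z, u). h (\<lambda>i\<in>{..<n}. z i + r * u i) * indicator (cube n 1) u)
        \<in> borel_measurable (\<mu> \<Otimes>\<^sub>M leb n)"
      unfolding case_prod_beta by measurable
    then have [measurable]: "(\<lambda>z. \<integral>\<^sup>+u. h (\<lambda>i\<in>{..<n}. z i + r * u i) * indicator (cube n 1) u \<partial>leb n)
        \<in> borel_measurable \<mu>"
      by (rule L.borel_measurable_nn_integral)
    have [measurable]: "cube n k \<in> sets \<mu>" using cube_sets sets_\<mu> by simp
    show ?thesis by measurable
  qed
  have "ennreal ((2 * r) ^ n * ?m) * (\<integral>\<^sup>+x. ennreal (smooth n \<mu> k r x) * h x \<partial>leb n)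
      = (\<integral>\<^sup>+x. \<integral>\<^sup>+z. h x * ?W x z \<partial>\<mu> \<partial>leb n)"
    unfolding pt[symmetric] by (rule nn_integral_cmult[symmetric]) measurable
  also have "\<dots> = (\<integral>\<^sup>+z. \<integral>\<^sup>+x. h x * ?W x z \<partial>leb n \<partial>\<mu>)"
    by (rule LM.Fubini'[symmetric]) (rule meas)
  also have "\<dots> = (\<integral>\<^sup>+z. ennreal (r ^ n) * ?I z \<partial>\<mu>)"
    by (intro nn_integral_cong inner)
  also have "\<dots> = ennreal (r ^ n) * (\<integral>\<^sup>+z. ?I z \<partial>\<mu>)"
    by (rule nn_integral_cmult[OF measI])
  finally have "ennreal (r ^ n) * (ennreal (2 ^ n * ?m) * (\<integral>\<^sup>+x. ennreal (smooth n \<mu> k r x) * h x \<partial>leb n))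
     = ennreal (r ^ n) * (\<integral>\<^sup>+z. ?I z \<partial>\<mu>)"
    using r_pos by (simp add: power_mult_distrib ennreal_mult ac_simps)
  moreover have "ennreal (r ^ n) \<noteq> 0" using r_pos by simp
  ultimately show ?thesis by (simp add: ennreal_mult_cancel_left)
qed

text \<open>
The defining inequality for the two windows; when a window is empty the left-hand side is 0.
\<close>

lemma smooth_log_concave:
  assumes l: "0 < l" "l < 1"
  shows "smooth n \<mu> k r x powr l * smooth n \<mu> k r y powr (1 - l) \<le> smooth n \<mu> k r (comb n l x y)"
proof -
  let ?c = "(2 * r) ^ n * measure \<mu> (cube n k)"
  let ?w = "\<lambda>x. measure \<mu> (window n k r x)"
  have c: "?c > 0" using r_pos mass_pos by simp
  have "?w x powr l * ?w y powr (1 - l) \<le> ?w (comb n l x y)"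
  proof (cases "window n k r x = {} \<or> window n k r y = {}")
    case False
    then have "?w x powr l * ?w y powr (1 - l) \<le> measure \<mu> (mink_comb n l (window n k r x) (window n k r y))"
      using lc l compact_window unfolding log_concave_prob_def by blast
    also have "\<dots> \<le> ?w (comb n l x y)"
      by (intro finite_measure_mono mink_comb_window l) measurable
    finally show ?thesis .
  qed (use l in auto)
  then have "(?w x powr l * ?w y powr (1 - l)) / ?c \<le> ?w (comb n l x y) / ?c"
    using c by (intro divide_right_mono) auto
  moreover have "(?w x / ?c) powr l * (?w y / ?c) powr (1 - l) = (?w x powr l * ?w y powr (1 - l)) / ?c"
  proof -
    have "?c powr l * ?c powr (1 - l) = ?c" using c by (simp add: powr_add[symmetric])
    then show ?thesis using c by (simp add: powr_divide)
  qed
  ultimately show ?thesis by (simp add: smooth_def)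
qed

lemma smooth_total: "(\<integral>\<^sup>+x. ennreal (smooth n \<mu> k r x) \<partial>leb n) = 1"
proof -
  let ?m = "measure \<mu> (cube n k)"
  have "cube n k \<in> events" using cube_sets sets_\<mu> by simp
  then have "ennreal (2 ^ n * ?m) * (\<integral>\<^sup>+x. ennreal (smooth n \<mu> k r x) \<partial>leb n) = ennreal (2 ^ n * ?m) * 1"
    using smooth_integral[of "\<lambda>_. 1"] mass_pos
    by (simp add: emeasure_leb_cube nn_integral_multc emeasure_eq_measure ennreal_mult'[symmetric] mult.commute)
  moreover have "ennreal (2 ^ n * ?m) \<noteq> 0" using mass_pos by simp
  ultimately show ?thesis by (simp only: ennreal_mult_cancel_left) simp
qed

sublocale log_concave_density n "smooth n \<mu> k r"
proof
  show "smooth n \<mu> k r \<in> borel_measurable (leb n)" by (rule measurable_smooth)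
  show "\<exists>B. \<forall>x. smooth n \<mu> k r x \<le> B"
    using r_pos mass_pos prob_le_1 unfolding smooth_def
    by (intro exI[of _ "1 / ((2 * r) ^ n * measure \<mu> (cube n k))"] allI divide_right_mono) auto
  show "\<exists>R. \<forall>x\<in>Rn n. smooth n \<mu> k r x \<noteq> 0 \<longrightarrow> x \<in> cube n R"
  proof (intro exI[of _ "k + r"] ballI impI)
    fix x assume x: "x \<in> Rn n" "smooth n \<mu> k r x \<noteq> 0"
    then obtain z where "z \<in> window n k r x" unfolding smooth_def by fastforce
    then show "x \<in> cube n (k + r)"
      using x(1) by (force simp: window_iff cube_iff)
  qed
qed (use smooth_nonneg smooth_log_concave smooth_total in auto)

end

lemma dot_shift_bound:
  assumes u: "u \<in> cube n 1" and r: "r \<ge> 0"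
  shows "\<bar>dot n \<theta> (\<lambda>i\<in>{..<n}. z i + r * u i) - dot n \<theta> z\<bar> \<le> r * (\<Sum>i<n. \<bar>\<theta> i\<bar>)"
proof -
  have "dot n \<theta> (\<lambda>i\<in>{..<n}. z i + r * u i) - dot n \<theta> z = (\<Sum>i<n. r * (\<theta> i * u i))"
    unfolding dot_def sum_subtractf[symmetric] by (intro sum.cong) (auto simp: algebra_simps)
  also have "\<bar>\<dots>\<bar> \<le> (\<Sum>i<n. r * \<bar>\<theta> i\<bar>)"
  proof (rule order.trans[OF sum_abs sum_mono])
    fix i assume "i \<in> {..<n}"
    then have "\<bar>\<theta> i\<bar> * \<bar>u i\<bar> \<le> \<bar>\<theta> i\<bar> * 1" using u by (intro mult_left_mono) (auto simp: cube_iff)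
    then show "\<bar>r * (\<theta> i * u i)\<bar> \<le> r * \<bar>\<theta> i\<bar>"
      using r by (simp add: abs_mult mult_left_mono)
  qed
  finally show ?thesis by (simp add: sum_distrib_left)
qed

lemma exists_cube:
  assumes "x \<in> Rn n"
  shows "\<exists>j::nat. x \<in> cube n (real j)"
proof -
  obtain j where j: "(\<Sum>i<n. \<bar>x i\<bar>) \<le> real j" using real_arch_simple by blast
  have "\<bar>x i\<bar> \<le> (\<Sum>i<n. \<bar>x i\<bar>)" if "i < n" for i
    using that by (intro member_le_sum) auto
  then have "x \<in> cube n (real j)" using assms j unfolding cube_iff by (meson order_trans)
  then show ?thesis ..
qed

context log_concave_smoothing
begin

lemma law_integral:
  assumes [measurable]: "h \<in> borel_measurable (leb n)"
  shows "ennreal (2 ^ n * measure \<mu> (cube n k)) * (\<integral>\<^sup>+x. h x \<partial>law)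
    = (\<integral>\<^sup>+z. indicator (cube n k) z * (\<integral>\<^sup>+u. h (\<lambda>i\<in>{..<n}. z i + r * u i) * indicator (cube n 1) u \<partial>leb n) \<partial>\<mu>)"
  using smooth_integral[OF assms] nn_integral_law[OF assms] by simp

text \<open>
Conditioning on the cube costs the factor \<open>1 / \<mu> (cube n k)\<close> and the displacement \<open>r u\<close> changes
\<open>\<theta> \<cdot> z\<close> by at most \<open>r\<close> times the sum norm of \<open>\<theta>\<close>. An upper bound for the Laplace transform of the
approximation makes its excess set large, as the limit argument demands.
\<close>

lemma law_laplace_le:
  "ennreal (measure \<mu> (cube n k)) * laplace n law \<theta>
     \<le> ennreal (exp (r * (\<Sum>i<n. \<bar>\<theta> i\<bar>))) * laplace n \<mu> \<theta>"
proof -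
  let ?S = "\<Sum>i<n. \<bar>\<theta> i\<bar>"
  let ?m = "measure \<mu> (cube n k)"
  have [measurable]: "dot n \<theta> \<in> borel_measurable \<mu>"
    using measurable_dot[of n \<theta>] measurable_cong_sets[OF sets_\<mu> refl] by blast
  have shift: "dot n \<theta> (\<lambda>i\<in>{..<n}. z i + r * u i) \<le> r * ?S + dot n \<theta> z" if "u \<in> cube n 1" for z u
    using dot_shift_bound[OF that, of r \<theta> z] r_pos by (simp add: abs_le_iff)
  have "ennreal (2 ^ n) * (ennreal ?m * laplace n law \<theta>)
      = (\<integral>\<^sup>+z. indicator (cube n k) z * (\<integral>\<^sup>+u. ennreal (exp (dot n \<theta> (\<lambda>i\<in>{..<n}. z i + r * u i))) *
           indicator (cube n 1) u \<partial>leb n) \<partial>\<mu>)"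
    using law_integral[of "\<lambda>x. ennreal (exp (dot n \<theta> x))"]
    by (simp add: laplace_def ennreal_mult' mult.assoc)
  also have "\<dots> \<le> (\<integral>\<^sup>+z. (\<integral>\<^sup>+u. ennreal (exp (r * ?S + dot n \<theta> z)) * indicator (cube n 1) u \<partial>leb n) \<partial>\<mu>)"
  proof (rule nn_integral_mono)
    fix z
    have "(\<integral>\<^sup>+u. ennreal (exp (dot n \<theta> (\<lambda>i\<in>{..<n}. z i + r * u i))) * indicator (cube n 1) u \<partial>leb n)
      \<le> (\<integral>\<^sup>+u. ennreal (exp (r * ?S + dot n \<theta> z)) * indicator (cube n 1) u \<partial>leb n)"
      using shift by (intro nn_integral_mono) (auto simp: indicator_def intro!: ennreal_leI)
    then show "indicator (cube n k) z * (\<integral>\<^sup>+u. ennreal (exp (dot n \<theta> (\<lambda>i\<in>{..<n}. z i + r * u i))) *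
           indicator (cube n 1) u \<partial>leb n) \<le> (\<integral>\<^sup>+u. ennreal (exp (r * ?S + dot n \<theta> z)) * indicator (cube n 1) u \<partial>leb n)"
      by (cases "z \<in> cube n k") auto
  qed
  also have "\<dots> = (\<integral>\<^sup>+z. ennreal (2 ^ n) * (ennreal (exp (r * ?S)) * ennreal (exp (dot n \<theta> z))) \<partial>\<mu>)"
  proof (rule nn_integral_cong)
    fix z
    have "(\<integral>\<^sup>+u. ennreal (exp (r * ?S + dot n \<theta> z)) * indicator (cube n 1) u \<partial>leb n)
        = ennreal (exp (r * ?S + dot n \<theta> z)) * ennreal (2 ^ n)"
      by (subst nn_integral_cmult_indicator) (auto simp: emeasure_leb_cube)
    then show "(\<integral>\<^sup>+u. ennreal (exp (r * ?S + dot n \<theta> z)) * indicator (cube n 1) u \<partial>leb n)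
        = ennreal (2 ^ n) * (ennreal (exp (r * ?S)) * ennreal (exp (dot n \<theta> z)))"
      by (simp add: exp_add ennreal_mult' mult.commute)
  qed
  also have "\<dots> = ennreal (2 ^ n) * (ennreal (exp (r * ?S)) * laplace n \<mu> \<theta>)"
    unfolding laplace_def by (simp add: nn_integral_cmult)
  finally show ?thesis
    by (subst (asm) ennreal_mult_le_mult_iff) auto
qed

lemma law_measure_integral:
  assumes "A \<in> sets (leb n)"
  shows "(\<integral>\<^sup>+z. (\<integral>\<^sup>+u. indicator (cube n k) z * (indicator A (\<lambda>i\<in>{..<n}. z i + r * u i) * indicator (cube n 1) u) \<partial>leb n) \<partial>\<mu>)
    = ennreal (2 ^ n * measure \<mu> (cube n k) * measure law A)"
    and "(\<lambda>z. \<integral>\<^sup>+u. indicator (cube n k) z * (indicator A (\<lambda>i\<in>{..<n}. z i + r * u i) * indicator (cube n 1) u) \<partial>leb n)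
      \<in> borel_measurable \<mu>"
    and "\<And>z. (\<lambda>u. indicator (cube n k) z * (indicator A (\<lambda>i\<in>{..<n}. z i + r * u i) * indicator (cube n 1) u) :: ennreal)
      \<in> borel_measurable (leb n)"
proof -
  note [measurable] = assms
  have [measurable]: "(\<lambda>u. \<lambda>i\<in>{..<n}. z i + r * u i) \<in> measurable (leb n) (leb n)" for z
    using measurable_affine[where n = n and a = z and c = r] .
  show "(\<lambda>u. indicator (cube n k) z * (indicator A (\<lambda>i\<in>{..<n}. z i + r * u i) * indicator (cube n 1) u) :: ennreal)
      \<in> borel_measurable (leb n)" for z by measurable
  interpret L: sigma_finite_measure "leb n" by (rule sigma_finite_leb)
  have [measurable]: "(\<lambda>p. \<lambda>i\<in>{..<n}. fst p i + r * snd p i) \<in> measurable (\<mu> \<Otimes>\<^sub>M leb n) (leb n)"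
    using measurable_shift[where n = n and r = r] measurable_cong_sets[OF sets_pair_measure_cong[OF sets_\<mu> refl] refl]
    by blast
  have [measurable]: "cube n k \<in> sets \<mu>" using cube_sets sets_\<mu> by simp
  have "(\<lambda>(z, u). indicator (cube n k) z * (indicator A (\<lambda>i\<in>{..<n}. z i + r * u i) * indicator (cube n 1) u) :: ennreal)
      \<in> borel_measurable (\<mu> \<Otimes>\<^sub>M leb n)"
    unfolding case_prod_beta by measurable
  then show "(\<lambda>z. \<integral>\<^sup>+u. indicator (cube n k) z * (indicator A (\<lambda>i\<in>{..<n}. z i + r * u i) * indicator (cube n 1) u) \<partial>leb n)
      \<in> borel_measurable \<mu>"
    by (rule L.borel_measurable_nn_integral)
  have "(\<integral>\<^sup>+z. (\<integral>\<^sup>+u. indicator (cube n k) z * (indicator A (\<lambda>i\<in>{..<n}. z i + r * u i) * indicator (cube n 1) u) \<partial>leb n) \<partial>\<mu>)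
      = ennreal (2 ^ n * measure \<mu> (cube n k)) * (\<integral>\<^sup>+x. indicator A x \<partial>law)"
    by (subst law_integral) (auto intro!: nn_integral_cong nn_integral_cmult)
  also have "\<dots> = ennreal (2 ^ n * measure \<mu> (cube n k) * measure law A)"
    using assms by (simp add: law.emeasure_eq_measure ennreal_mult')
  finally show "(\<integral>\<^sup>+z. (\<integral>\<^sup>+u. indicator (cube n k) z * (indicator A (\<lambda>i\<in>{..<n}. z i + r * u i) * indicator (cube n 1) u) \<partial>leb n) \<partial>\<mu>)
    = ennreal (2 ^ n * measure \<mu> (cube n k) * measure law A)" .
qed

end

text \<open>
Let the cubes exhaust the space and the displacement tend to 0. If \<open>z\<close> is in the excess set of
\<open>\<mu>\<close>, witnessed by \<open>\<theta>\<close>, the same \<open>\<theta>\<close> shows that \<open>z + r u\<close> is eventually in the excess set of the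
approximation. Hence the indicator of the excess set is at most the lower limit of the
approximating ones, and Fatou's lemma, applied in \<open>u\<close> and then in \<open>z\<close>, gives the bound.
\<close>

lemma log_concave_measure_excess_le:
  assumes lc: "log_concave_prob n \<mu>"
    and dens: "\<And>f. log_concave_density n f \<Longrightarrow>
      measure (log_concave_density.law n f) (excess n (log_concave_density.law n f) T) \<le> p"
  shows "measure \<mu> (excess n \<mu> T) \<le> p"
proof -
  interpret prob_space \<mu> using lc by (simp add: log_concave_prob_def borel_prob_Rn_def)
  have sets_\<mu>: "sets \<mu> = sets (leb n)"
    using lc by (simp add: log_concave_prob_def borel_prob_Rn_def sets_leb)
  have space_\<mu>: "space \<mu> = Rn n" using sets_eq_imp_space_eq[OF sets_\<mu>] by simp
  let ?m = "\<lambda>j. measure \<mu> (cube n (real j))"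
  let ?r = "\<lambda>j. 1 / real (Suc j)"
  have cubes: "cube n t \<in> events" for t using cube_sets sets_\<mu> by simp
  have m_lim: "?m \<longlonglongrightarrow> 1"
  proof -
    have "?m \<longlonglongrightarrow> measure \<mu> (\<Union>j. cube n (real j))"
      using cubes by (intro finite_Lim_measure_incseq) (force simp: incseq_def cube_iff)+
    moreover have "(\<Union>j. cube n (real j)) = space \<mu>"
      using exists_cube by (auto simp: space_\<mu> cube_iff)
    ultimately show ?thesis by (simp add: prob_space)
  qed
  then have "eventually (\<lambda>j. ?m j > 0) sequentially" by (rule order_tendstoD) simp
  then obtain J where J: "\<And>j. j \<ge> J \<Longrightarrow> ?m j > 0" by (auto simp: eventually_sequentially)
  have smoothing: "log_concave_smoothing n \<mu> (real j) (?r j)" if "j \<ge> J" for j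
    by unfold_locales (use lc J[OF that] in auto)
  define P where "P = (\<lambda>j. log_concave_density.law n (smooth n \<mu> (real j) (?r j)))"
  define D where "D = (\<lambda>j. excess n (P j) T)"
  define G where "G = (\<lambda>j z u. indicator (cube n (real j)) z *
      (indicator (D j) (\<lambda>i\<in>{..<n}. z i + ?r j * u i) * indicator (cube n 1) u) :: ennreal)"
  have PD: "measure (P j) (D j) \<le> p" if "j \<ge> J" for j
  proof -
    interpret log_concave_smoothing n \<mu> "real j" "?r j" by (rule smoothing[OF that])
    show ?thesis unfolding P_def D_def by (rule dens) unfold_locales
  qed
  have p0: "p \<ge> 0" using PD[of J] measure_nonneg[of "P J" "D J"] by linarith
  have Gint: "(\<integral>\<^sup>+z. (\<integral>\<^sup>+u. G j z u \<partial>leb n) \<partial>\<mu>) \<le> ennreal (2 ^ n * p)"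
    and Gmeas: "(\<lambda>z. \<integral>\<^sup>+u. G j z u \<partial>leb n) \<in> borel_measurable \<mu>"
    and Gmeas': "\<And>z. (\<lambda>u. G j z u) \<in> borel_measurable (leb n)" if "j \<ge> J" for j
  proof -
    interpret log_concave_smoothing n \<mu> "real j" "?r j" by (rule smoothing[OF that])
    note * = law_measure_integral[OF excess_sets[of n law T]]
    show "(\<lambda>z. \<integral>\<^sup>+u. G j z u \<partial>leb n) \<in> borel_measurable \<mu>"
      unfolding G_def D_def P_def by (rule *(2))
    show "(\<lambda>u. G j z u) \<in> borel_measurable (leb n)" for z
      unfolding G_def D_def P_def by (rule *(3))
    have "(\<integral>\<^sup>+z. (\<integral>\<^sup>+u. G j z u \<partial>leb n) \<partial>\<mu>) = ennreal (2 ^ n * ?m j * measure (P j) (D j))"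
      unfolding G_def D_def P_def by (rule *(1))
    also have "\<dots> \<le> ennreal (2 ^ n * 1 * p)"
      using PD[OF that] p0 by (intro ennreal_leI mult_mono) auto
    finally show "(\<integral>\<^sup>+z. (\<integral>\<^sup>+u. G j z u \<partial>leb n) \<partial>\<mu>) \<le> ennreal (2 ^ n * p)" by simp
  qed
  have ptw: "indicator (excess n \<mu> T) z * indicator (cube n 1) u \<le> liminf (\<lambda>j. G (j + J) z u)"
    for z u
  proof (cases "z \<in> excess n \<mu> T \<and> u \<in> cube n 1")
    case True
    then have z: "z \<in> Rn n" and u: "u \<in> cube n 1" by (auto simp: excess_def)
    \<comment> \<open>The inequality witnessed by \<open>\<theta>\<close> is strict, so it survives the vanishing perturbations.\<close>
    obtain \<theta> where \<theta>: "\<theta> \<in> Rn n" "ennreal (exp T) * laplace n \<mu> \<theta> < ennreal (exp (dot n \<theta> z))"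
      using True by (auto simp: excess_def)
    let ?S = "\<Sum>i<n. \<bar>\<theta> i\<bar>"
    have "laplace n \<mu> \<theta> \<noteq> \<infinity>"
      using \<theta>(2) by (auto simp: ennreal_mult_top)
    then obtain L where L: "laplace n \<mu> \<theta> = ennreal L" "L \<ge> 0" by (cases "laplace n \<mu> \<theta>") auto
    have lt: "exp T * L < exp (dot n \<theta> z)"
      using \<theta>(2) L by (simp add: ennreal_mult'[symmetric] ennreal_less_iff)
    have r_lim: "?r \<longlonglongrightarrow> 0" by (rule LIMSEQ_Suc[OF lim_1_over_n])
    have "(\<lambda>j. exp T * (exp (?r j * ?S) * L / ?m j)) \<longlonglongrightarrow> exp T * (exp (0 * ?S) * L / 1)"
      by (intro tendsto_intros r_lim m_lim) auto
    moreover have "(\<lambda>j. exp (dot n \<theta> z - ?r j * ?S)) \<longlonglongrightarrow> exp (dot n \<theta> z - 0 * ?S)"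
      by (intro tendsto_intros r_lim)
    ultimately have "(\<lambda>j. exp (dot n \<theta> z - ?r j * ?S) - exp T * (exp (?r j * ?S) * L / ?m j))
        \<longlonglongrightarrow> exp (dot n \<theta> z - 0 * ?S) - exp T * (exp (0 * ?S) * L / 1)"
      by (intro tendsto_diff)
    then have "eventually (\<lambda>j. 0 < exp (dot n \<theta> z - ?r j * ?S) - exp T * (exp (?r j * ?S) * L / ?m j)) sequentially"
      by (rule order_tendstoD) (use lt in simp)
    then have ev: "eventually (\<lambda>j. exp T * (exp (?r j * ?S) * L / ?m j) < exp (dot n \<theta> z - ?r j * ?S)) sequentially"
      by (rule eventually_mono) simp
    obtain j0 where j0: "z \<in> cube n (real j0)" using exists_cube[OF z] by blast
    have "eventually (\<lambda>j. 1 \<le> G j z u) sequentially"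
      using ev eventually_ge_at_top[of J] eventually_ge_at_top[of j0]
    proof eventually_elim
      case (elim j)
      interpret log_concave_smoothing n \<mu> "real j" "?r j" by (rule smoothing[OF elim(2)])
      let ?x = "\<lambda>i\<in>{..<n}. z i + ?r j * u i"
      have zc: "z \<in> cube n (real j)" using j0 elim(3) by (force simp: cube_iff)
      have "ennreal (?m j) * laplace n law \<theta> \<le> ennreal (exp (?r j * ?S) * L)"
        using law_laplace_le[of \<theta>] unfolding L(1) by (subst ennreal_mult') auto
      then have "ennreal (?m j * (\<integral>x. exp (dot n \<theta> x) \<partial>law)) \<le> ennreal (exp (?r j * ?S) * L)"
        unfolding laplace_law by (subst ennreal_mult') auto
      then have "?m j * (\<integral>x. exp (dot n \<theta> x) \<partial>law) \<le> exp (?r j * ?S) * L"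
        using L(2) by (subst (asm) ennreal_le_iff) auto
      then have "(\<integral>x. exp (dot n \<theta> x) \<partial>law) \<le> exp (?r j * ?S) * L / ?m j"
        using J[OF elim(2)] by (simp add: pos_le_divide_eq mult.commute)
      then have "laplace n law \<theta> \<le> ennreal (exp (?r j * ?S) * L / ?m j)"
        unfolding laplace_law by (rule ennreal_leI)
      then have "ennreal (exp T) * laplace n law \<theta> \<le> ennreal (exp T) * ennreal (exp (?r j * ?S) * L / ?m j)"
        by (rule mult_left_mono) simp
      also have "\<dots> = ennreal (exp T * (exp (?r j * ?S) * L / ?m j))"
        by (rule ennreal_mult'[symmetric]) simp
      also have "\<dots> < ennreal (exp (dot n \<theta> z - ?r j * ?S))"
        using elim(1) L J[OF elim(2)] by (intro ennreal_lessI) auto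
      also have "\<dots> \<le> ennreal (exp (dot n \<theta> ?x))"
        using dot_shift_bound[OF u, of "?r j" \<theta> z] by (intro ennreal_leI) (simp add: abs_le_iff)
      finally have "?x \<in> D j" using \<theta>(1) unfolding D_def P_def excess_def by auto
      then show ?case using zc u by (simp add: G_def)
    qed
    then have "eventually (\<lambda>j. 1 \<le> G (j + J) z u) sequentially"
      by (rule sequentially_offset)
    then show ?thesis using True by (auto intro: Liminf_bounded)
  qed (auto simp: indicator_def)
  have "ennreal (2 ^ n * measure \<mu> (excess n \<mu> T))
     = (\<integral>\<^sup>+z. (\<integral>\<^sup>+u. indicator (excess n \<mu> T) z * indicator (cube n 1) u \<partial>leb n) \<partial>\<mu>)"
  proof -
    have "(\<integral>\<^sup>+u. indicator (excess n \<mu> T) z * indicator (cube n 1) u \<partial>leb n)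
        = ennreal (2 ^ n) * indicator (excess n \<mu> T) z" for z
      by (subst nn_integral_cmult_indicator) (auto simp: emeasure_leb_cube mult.commute)
    moreover have "excess n \<mu> T \<in> events" using excess_sets sets_\<mu> by simp
    ultimately show ?thesis
      by (simp add: nn_integral_cmult emeasure_eq_measure ennreal_mult')
  qed
  also have "\<dots> \<le> (\<integral>\<^sup>+z. (\<integral>\<^sup>+u. liminf (\<lambda>j. G (j + J) z u) \<partial>leb n) \<partial>\<mu>)"
    by (intro nn_integral_mono ptw)
  also have "\<dots> \<le> (\<integral>\<^sup>+z. liminf (\<lambda>j. \<integral>\<^sup>+u. G (j + J) z u \<partial>leb n) \<partial>\<mu>)"
    by (intro nn_integral_mono nn_integral_liminf Gmeas') auto
  also have "\<dots> \<le> liminf (\<lambda>j. \<integral>\<^sup>+z. (\<integral>\<^sup>+u. G (j + J) z u \<partial>leb n) \<partial>\<mu>)"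
    by (intro nn_integral_liminf Gmeas) auto
  also have "\<dots> \<le> liminf (\<lambda>j::nat. ennreal (2 ^ n * p))"
    by (intro Liminf_mono always_eventually allI Gint) auto
  also have "\<dots> = ennreal (2 ^ n * p)" by (simp add: Liminf_const)
  finally show ?thesis using p0 by (simp add: ennreal_le_iff)
qed

section \<open>The tail of the Cramer transform\<close>

lemma excess_antimono:
  assumes "S \<le> T"
  shows "excess n \<mu> T \<subseteq> excess n \<mu> S"
proof
  fix x assume "x \<in> excess n \<mu> T"
  then obtain \<theta> where \<theta>: "x \<in> Rn n" "\<theta> \<in> Rn n"
    "ennreal (exp T) * laplace n \<mu> \<theta> < ennreal (exp (dot n \<theta> x))"
    by (auto simp: excess_def)
  have "ennreal (exp S) * laplace n \<mu> \<theta> \<le> ennreal (exp T) * laplace n \<mu> \<theta>"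
    using assms by (intro mult_right_mono ennreal_leI) auto
  then show "x \<in> excess n \<mu> S" using \<theta> unfolding excess_def by (auto intro: le_less_trans)
qed

lemma log_concave_prob_space:
  assumes "log_concave_prob n \<mu>"
  shows "prob_space \<mu>" "sets \<mu> = sets (leb n)" "space \<mu> = Rn n"
proof -
  show "prob_space \<mu>" and *: "sets \<mu> = sets (leb n)"
    using assms by (auto simp: log_concave_prob_def borel_prob_Rn_def sets_leb)
  show "space \<mu> = Rn n" using sets_eq_imp_space_eq[OF *] by simp
qed

lemma measure_excess_mono:
  assumes "log_concave_prob n \<mu>" "S \<le> T"
  shows "measure \<mu> (excess n \<mu> T) \<le> measure \<mu> (excess n \<mu> S)"
proof -
  interpret prob_space \<mu> using log_concave_prob_space(1)[OF assms(1)] .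
  show ?thesis
    using excess_sets log_concave_prob_space(2)[OF assms(1)]
    by (intro finite_measure_mono excess_antimono assms) auto
qed

lemma excess_tail_linear:
  assumes "log_concave_prob n \<mu>" "n \<ge> 1" "w \<ge> 0"
  shows "measure \<mu> (excess n \<mu> (real n * ln (real n) + 5 * real n * (1 + w))) \<le> 6 * exp (- w)"
  by (rule log_concave_measure_excess_le[OF assms(1)])
    (rule log_concave_density.excess_mass_le_exp[OF _ assms(2,3)])

text \<open>
In dimension one the constants of \<open>excess_mass_le_exp\<close> with \<open>w = 11\<close> give mass at most \<open>1 / 2\<close> to the
excess set of height \<open>60 = 5 * (1 + 11)\<close>; lower heights follow by contraction.
\<close>

lemma excess_tail_1:
  assumes lc: "log_concave_prob 1 \<mu>" and l: "0 < l" "l < 1"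
  shows "measure \<mu> (excess 1 \<mu> (l * 60)) \<le> 1 - l * exp (- 2) / 2"
proof (rule log_concave_measure_excess_le[OF lc])
  fix f assume "log_concave_density 1 f"
  then interpret log_concave_density 1 f .
  have "measure law (excess 1 law 60) \<le> 6 * exp (- 11)"
    using excess_mass_le_exp[of 11] by simp
  also have "\<dots> \<le> 1 / 2"
    using exp_ge_add_one_self[of "11::real"] by (simp add: exp_minus field_simps)
  finally have "l * exp (- 2) * (1 / 2) \<le> l * exp (- 2) * (1 - measure law (excess 1 law 60))"
    using l by (intro mult_left_mono) auto
  then show "measure law (excess 1 law (l * 60)) \<le> 1 - l * exp (- 2) / 2"
    using excess_mass_contract_1[OF _ l, of 60] by simp
qed

text \<open>
In dimension one and for small \<open>u\<close>, contraction by \<open>l = 2 * exp 2 * u\<close> gives mass at most \<open>1 - u\<close> to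
the excess set of height \<open>60 * l\<close>, which dictates this value.
\<close>

definition tail_const :: real where
  "tail_const = 120 * exp 2"

lemma tail_const_ge: "tail_const \<ge> 61" "tail_const \<ge> 60 * exp 2 + 5" "tail_const > 0"
  using exp_ge_add_one_self[of "2::real"] by (auto simp: tail_const_def)

text \<open>
With \<open>w = u + ln 6\<close> the factor 6 of the linear bound disappears, at the cost of a constant multiple of
\<open>n\<close> in the height. For \<open>n \<ge> 2\<close> this is absorbed by \<open>n * ln n\<close>, and for \<open>n = 1\<close> by \<open>u\<close> unless
\<open>u\<close> is small; there the contraction bound takes over.
\<close>

lemma excess_tail:
  assumes lc: "log_concave_prob n \<mu>" and n: "n \<ge> 1" and u: "u \<ge> 0"
  shows "measure \<mu> (excess n \<mu> (tail_const * real n * (ln (real n) + u))) \<le> exp (- u)"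
proof -
  interpret prob_space \<mu> using log_concave_prob_space(1)[OF lc] .
  have "ln (6::real) \<le> 5" using ln_le_minus_one[of "6::real"] by simp
  then have lin: "real n * ln (real n) + 5 * real n * (1 + (u + ln 6)) \<le> real n * (ln (real n) + 30 + 5 * u)"
  proof -
    assume "ln (6::real) \<le> 5"
    then have "real n * (ln (real n) + 5 * (1 + (u + ln 6))) \<le> real n * (ln (real n) + 30 + 5 * u)"
      by (intro mult_left_mono) auto
    then show ?thesis by (simp add: algebra_simps)
  qed
  have main: ?thesis if "real n * (ln (real n) + 30 + 5 * u) \<le> tail_const * real n * (ln (real n) + u)"
  proof -
    have "measure \<mu> (excess n \<mu> (tail_const * real n * (ln (real n) + u)))
        \<le> measure \<mu> (excess n \<mu> (real n * ln (real n) + 5 * real n * (1 + (u + ln 6))))"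
      using lin that by (intro measure_excess_mono lc) linarith
    also have "\<dots> \<le> 6 * exp (- (u + ln 6))"
      using u by (intro excess_tail_linear lc n) auto
    also have "\<dots> = exp (- u)" by (simp add: exp_add exp_minus exp_diff)
    finally show ?thesis .
  qed
  show ?thesis
  proof (cases "n = 1")
    case False
    then have n2: "real n \<ge> 2" using n by simp
    have "ln (1 / 2) \<le> 1 / 2 - (1::real)" by (rule ln_le_minus_one) simp
    then have "ln 2 \<ge> 1 / (2::real)" by (simp add: ln_div)
    then have l: "ln (real n) \<ge> 1 / 2" using n2 ln_le_cancel_iff[of 2 "real n"] by linarith
    have "ln (real n) + 30 + 5 * u \<le> 61 * (ln (real n) + u)" using l u by simp
    also have "\<dots> \<le> tail_const * (ln (real n) + u)"
      using tail_const_ge(1) l u by (intro mult_right_mono) auto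
    finally have "ln (real n) + 30 + 5 * u \<le> tail_const * (ln (real n) + u)" .
    then have "real n * (ln (real n) + 30 + 5 * u) \<le> real n * (tail_const * (ln (real n) + u))"
      by (intro mult_left_mono) auto
    then show ?thesis by (intro main) (simp add: ac_simps)
  next
    case True
    \<comment> \<open>Below \<open>v\<close> the contraction factor \<open>2 * exp 2 * u\<close> is less than 1.\<close>
    define v where "v = 1 / (2 * exp (2::real))"
    show ?thesis
    proof (cases "u \<ge> v")
      case ge: True
      have "30 = 60 * exp 2 * v" by (simp add: v_def)
      also have "\<dots> \<le> 60 * exp 2 * u" using ge by (intro mult_left_mono) auto
      finally have "30 + 5 * u \<le> (60 * exp 2 + 5) * u" by (simp add: algebra_simps)
      also have "\<dots> \<le> tail_const * u" using u by (intro mult_right_mono tail_const_ge) auto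
      finally show ?thesis using True by (intro main) simp
    next
      case lt: False
      show ?thesis
      proof (cases "u = 0")
        case True
        then show ?thesis by simp
      next
        case False
        define l where "l = 2 * exp 2 * u"
        have l0: "0 < l" using u False by (simp add: l_def)
        have l1: "l < 1" using lt by (simp add: l_def v_def field_simps)
        have "measure \<mu> (excess 1 \<mu> (l * 60)) \<le> 1 - l * exp (- 2) / 2"
          using lc True by (intro excess_tail_1 l0 l1) simp
        also have "1 - l * exp (- 2) / 2 = 1 - u" by (simp add: l_def exp_minus)
        also have "\<dots> \<le> exp (- u)" using exp_ge_add_one_self[of "- u"] by simp
        finally show ?thesis using True by (simp add: l_def tail_const_def ac_simps)
      qed
    qed
  qed
qed

lemma cramer_tail:
  assumes "log_concave_prob n \<mu>" "n \<ge> 1" "u \<ge> 0"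
  shows "measure \<mu> {x \<in> space \<mu>. cramer n \<mu> x > ereal (tail_const * real n * (ln (real n) + u))} \<le> exp (- u)"
proof -
  note P = log_concave_prob_space[OF assms(1)]
  have "{x \<in> space \<mu>. cramer n \<mu> x > ereal (tail_const * real n * (ln (real n) + u))}
      = excess n \<mu> (tail_const * real n * (ln (real n) + u))"
    unfolding P(3)
  proof (intro set_eqI iffI)
    fix x assume x: "x \<in> excess n \<mu> (tail_const * real n * (ln (real n) + u))"
    then have "x \<in> Rn n" using excess_subset by blast
    then show "x \<in> {x \<in> Rn n. cramer n \<mu> x > ereal (tail_const * real n * (ln (real n) + u))}"
      using cramer_gt_iff[OF P(1,2)] x by simp
  next
    fix x assume "x \<in> {x \<in> Rn n. cramer n \<mu> x > ereal (tail_const * real n * (ln (real n) + u))}"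
    then have x: "x \<in> Rn n" and "cramer n \<mu> x > ereal (tail_const * real n * (ln (real n) + u))"
      by auto
    then show "x \<in> excess n \<mu> (tail_const * real n * (ln (real n) + u))"
      using cramer_gt_iff[OF P(1,2) x] by blast
  qed
  then show ?thesis using excess_tail[OF assms] by simp
qed

section \<open>Moments of the Cramer transform\<close>

lemma ennreal_rpow_le:
  assumes "x \<le> ennreal m" "0 \<le> m" "0 \<le> q"
  shows "ennreal_rpow x q \<le> ennreal (m powr q)"
proof -
  obtain a where a: "x = ennreal a" "a \<ge> 0"
    using assms(1) by (cases x) (auto simp: top_unique)
  then have "a \<le> m" using assms by (simp add: ennreal_le_iff)
  then show ?thesis using a assms by (auto simp: ennreal_rpow_def intro!: ennreal_leI powr_mono2)
qed

lemma cramer_nonneg: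
  assumes "prob_space \<mu>" "sets \<mu> = sets (leb n)"
  shows "cramer n \<mu> x \<ge> 0"
proof -
  interpret prob_space \<mu> by fact
  let ?z = "\<lambda>i\<in>{..<n}. 0 :: real"
  have d: "dot n ?z y = 0" for y by (simp add: dot_def)
  have "ereal (dot n ?z x) - log_laplace n \<mu> ?z = 0"
    by (simp add: d log_laplace_def emeasure_space_1 Let_def)
  then have "0 \<le> ereal (dot n ?z x) - log_laplace n \<mu> ?z" by simp
  also have "\<dots> \<le> cramer n \<mu> x" unfolding cramer_def
    by (rule SUP_upper[where f = "\<lambda>\<theta>. ereal (dot n \<theta> x) - log_laplace n \<mu> \<theta>"]) (intro PiE_I, auto)
  finally show ?thesis .
qed

text \<open>
Raised to the power \<open>p\<close>, the right-hand side grows in \<open>t\<close> only like \<open>exp (t / 2)\<close>, slowly enough to be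
summed against a tail of order \<open>exp (- t)\<close>.
\<close>

lemma linear_le_exp:
  fixes L p t :: real
  assumes "L \<ge> 0" "p \<ge> 1" "t \<ge> 0"
  shows "L + t \<le> 2 * (L + p) * exp (t / (2 * p))"
proof -
  have "L + t \<le> 2 * L + 2 * p * (t / (2 * p))" using assms by simp
  also have "\<dots> \<le> 2 * (L + p) * (1 + t / (2 * p))"
    using assms by (simp add: algebra_simps)
  also have "\<dots> \<le> 2 * (L + p) * exp (t / (2 * p))"
    using assms by (intro mult_left_mono exp_ge_add_one_self) auto
  finally show ?thesis .
qed

text \<open>
If the transform is at most \<open>A * L\<close>, the summand 1 suffices. If it lies
between \<open>A * (L + j)\<close> and \<open>A * (L + j + 1)\<close>, the \<open>j\<close>-th
summand of the series suffices; at infinite values all summands are present and the series diverges.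
\<close>

lemma cramer_power_le:
  fixes A L p :: real
  assumes P: "prob_space \<mu>" "sets \<mu> = sets (leb n)" and x: "x \<in> Rn n"
    and A: "A > 0" and L: "L \<ge> 0" and p: "p \<ge> 1"
  shows "ennreal_rpow (e2ennreal \<bar>cramer n \<mu> x\<bar>) p \<le> ennreal ((2 * A * (L + p)) powr p) *
    (1 + (\<Sum>j. ennreal (exp (real (Suc j) / 2)) * indicator (excess n \<mu> (A * (L + real j))) x))"
    (is "?lhs \<le> ennreal (?K powr p) * (1 + ?S)")
proof -
  let ?E = "\<lambda>j. excess n \<mu> (A * (L + real j))"
  have K: "?K > 0" using A L p by simp
  have S: "ennreal (exp (real (Suc j) / 2)) \<le> ?S" if "x \<in> ?E j" for j
  proof -
    have "ennreal (exp (real (Suc j) / 2)) = (\<Sum>j\<in>{j}. ennreal (exp (real (Suc j) / 2)) * indicator (?E j) x)"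
      using that by simp
    also have "\<dots> \<le> ?S" by (intro sum_le_suminf) auto
    finally show ?thesis .
  qed
  show ?thesis
  proof (cases "cramer n \<mu> x")
    case PInf
    have "x \<in> ?E j" for j
      using cramer_gt_iff[OF P x, of "A * (L + real j)"] PInf by simp
    note S = S[OF this]
    have "?S = \<infinity>"
    proof (rule ccontr)
      assume "?S \<noteq> \<infinity>"
      then obtain N :: nat where N: "?S < of_nat N"
        using ennreal_Ex_less_of_nat[of ?S] by (auto simp: less_top[symmetric])
      have "of_nat N = ennreal (real N)" by (simp add: ennreal_of_nat_eq_real_of_nat)
      also have "\<dots> \<le> ennreal (exp (real (Suc (2 * N)) / 2))"
      proof (intro ennreal_leI)
        have "real N \<le> 1 + real (Suc (2 * N)) / 2" by (simp add: field_simps)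
        also have "\<dots> \<le> exp (real (Suc (2 * N)) / 2)" by (rule exp_ge_add_one_self)
        finally show "real N \<le> exp (real (Suc (2 * N)) / 2)" .
      qed
      also have "\<dots> \<le> ?S" by (rule S)
      finally show False using N by simp
    qed
    moreover have "ennreal (?K powr p) \<noteq> 0"
    proof -
      have "?K powr p > 0" unfolding powr_gt_zero by (rule less_imp_neq[OF K, symmetric])
      then show ?thesis by (simp only: ennreal_eq_0_iff not_le)
    qed
    ultimately show ?thesis by (simp only: ennreal_mult_top) simp
  next
    case MInf
    then show ?thesis using cramer_nonneg[OF P, of x] by simp
  next
    case (real c)
    then have c: "c \<ge> 0" using cramer_nonneg[OF P, of x] by simp
    have lhs: "?lhs = ennreal (c powr p)"
      using real c by (simp add: ennreal_rpow_def)
    show ?thesis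
    proof (cases "c \<le> A * L")
      case True
      also have "A * L \<le> ?K" using A L p by (simp add: algebra_simps)
      finally have "c powr p \<le> ?K powr p" using c p by (intro powr_mono2) auto
      then have "?lhs \<le> ennreal (?K powr p) * 1" unfolding lhs by (simp add: ennreal_leI)
      also have "\<dots> \<le> ennreal (?K powr p) * (1 + ?S)" by (intro mult_left_mono) auto
      finally show ?thesis .
    next
      case False
      define y where "y = c / A - L"
      have y: "y > 0" using False A by (simp add: y_def field_simps)
      define j where "j = nat (\<lceil>y\<rceil> - 1)"
      have "\<lceil>y\<rceil> \<ge> 1" using y by (simp add: one_le_ceiling)
      then have "real j = of_int \<lceil>y\<rceil> - 1" by (simp add: j_def)
      then have j: "real j < y" "y \<le> real (Suc j)" by linarith+
      have cy: "c = A * (L + y)" using A by (simp add: y_def)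
      have "A * (L + real j) < c" unfolding cy using j A by simp
      then have "x \<in> ?E j" using cramer_gt_iff[OF P x] real by simp
      note Sj = S[OF this]
      have "c \<le> A * (L + real (Suc j))" unfolding cy using j A by simp
      also have "\<dots> \<le> A * (2 * (L + p) * exp (real (Suc j) / (2 * p)))"
        using A L p by (intro mult_left_mono linear_le_exp) auto
      also have "\<dots> = ?K * exp (real (Suc j) / (2 * p))" by simp
      finally have "c powr p \<le> (?K * exp (real (Suc j) / (2 * p))) powr p"
        using c p by (intro powr_mono2) auto
      also have "\<dots> = ?K powr p * exp (real (Suc j) / 2)"
        using K p by (subst powr_mult) (auto simp: exp_powr_real)
      finally have "?lhs \<le> ennreal (?K powr p) * ennreal (exp (real (Suc j) / 2))"
        unfolding lhs by (subst ennreal_mult'[symmetric]) (auto intro: ennreal_leI)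
      also have "\<dots> \<le> ennreal (?K powr p) * (1 + ?S)"
        using Sj by (intro mult_left_mono add_increasing) auto
      finally show ?thesis .
    qed
  qed
qed

text \<open>
One plus the sum of \<open>exp ((j + 1) / 2) * exp (- j)\<close> over the natural numbers \<open>j\<close>.
\<close>

definition moment_const :: real where
  "moment_const = 1 + exp (1 / 2) * (1 / (1 - exp (- (1 / 2))))"

lemma moment_const_ge: "moment_const \<ge> 1"
  by (simp add: moment_const_def)

lemma tail_sum:
  "(\<Sum>j. ennreal (exp (real (Suc j) / 2)) * ennreal (exp (- real j))) = ennreal (exp (1 / 2) * (1 / (1 - exp (- (1 / 2)))))"
proof -
  let ?q = "exp (- (1 / 2)) :: real"
  have q: "0 < ?q" "?q < 1" by auto
  have "exp (real (Suc j) / 2) * exp (- real j) = exp (1 / 2) * ?q ^ j" for j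
    by (simp add: exp_of_nat_mult[symmetric] exp_add[symmetric] field_simps)
  then have "(\<Sum>j. ennreal (exp (real (Suc j) / 2)) * ennreal (exp (- real j))) = (\<Sum>j. ennreal (exp (1 / 2) * ?q ^ j))"
    by (simp add: ennreal_mult'[symmetric])
  also have "\<dots> = ennreal (\<Sum>j. exp (1 / 2) * ?q ^ j)"
    using q by (intro suminf_ennreal2 summable_mult summable_geometric) auto
  also have "(\<Sum>j. exp (1 / 2) * ?q ^ j) = exp (1 / 2) * (1 / (1 - ?q))"
    using q by (subst suminf_mult) (auto simp: suminf_geometric summable_geometric)
  finally show ?thesis .
qed

lemma cramer_Lp_norm:
  assumes lc: "log_concave_prob n \<mu>" and n: "n \<ge> 1" and p: "p \<ge> 1"
  shows "Lp_norm p \<mu> (cramer n \<mu>) \<le> ennreal (2 * tail_const * moment_const * real n * (ln (real n) + p))"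
proof -
  note P = log_concave_prob_space[OF lc]
  interpret prob_space \<mu> by (rule P(1))
  define A where "A = tail_const * real n"
  define L where "L = ln (real n)"
  have A: "A > 0" using tail_const_ge n by (simp add: A_def)
  have L: "L \<ge> 0" using n by (simp add: L_def)
  let ?K = "2 * A * (L + p)"
  have K: "?K > 0" using A L p by simp
  let ?E = "\<lambda>j. excess n \<mu> (A * (L + real j))"
  have E[measurable]: "?E j \<in> sets \<mu>" for j using excess_sets P(2) by simp
  have "(\<integral>\<^sup>+x. ennreal_rpow (e2ennreal \<bar>cramer n \<mu> x\<bar>) p \<partial>\<mu>)
      \<le> (\<integral>\<^sup>+x. ennreal (?K powr p) * (1 + (\<Sum>j. ennreal (exp (real (Suc j) / 2)) * indicator (?E j) x)) \<partial>\<mu>)"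
    using P(3) by (intro nn_integral_mono cramer_power_le P(1,2) A L p) simp
  also have "\<dots> = ennreal (?K powr p) * (1 + (\<Sum>j. ennreal (exp (real (Suc j) / 2)) * emeasure \<mu> (?E j)))"
    by (simp add: nn_integral_cmult nn_integral_add nn_integral_suminf emeasure_space_1)
  also have "\<dots> \<le> ennreal (?K powr p) * (1 + (\<Sum>j. ennreal (exp (real (Suc j) / 2)) * ennreal (exp (- real j))))"
  proof (intro mult_left_mono add_left_mono suminf_le)
    fix j
    show "emeasure \<mu> (?E j) \<le> ennreal (exp (- real j))"
      using excess_tail[OF lc n, of "real j"]
      by (simp add: emeasure_eq_measure A_def L_def ennreal_leI)
  qed auto
  also have "\<dots> = ennreal (?K powr p * moment_const)"
  proof -
    have "ennreal moment_const = 1 + ennreal (exp (1 / 2) * (1 / (1 - exp (- (1 / 2)))))"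
      unfolding moment_const_def by (subst ennreal_plus) auto
    then show ?thesis unfolding tail_sum by (subst ennreal_mult') auto
  qed
  finally have I: "(\<integral>\<^sup>+x. ennreal_rpow (e2ennreal \<bar>cramer n \<mu> x\<bar>) p \<partial>\<mu>) \<le> ennreal (?K powr p * moment_const)" .
  have "Lp_norm p \<mu> (cramer n \<mu>) \<le> ennreal ((?K powr p * moment_const) powr (1 / p))"
    unfolding Lp_norm_def using moment_const_ge p by (intro ennreal_rpow_le I) auto
  also have "\<dots> \<le> ennreal (?K * moment_const)"
  proof (rule ennreal_leI)
    have "(k powr p * m) powr (1 / p) \<le> k * m" if km: "k > 0" "m \<ge> 1" for k m :: real
    proof -
      have "(k powr p * m) powr (1 / p) = k * m powr (1 / p)"
        using km p by (simp add: powr_mult powr_powr)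
      also have "\<dots> \<le> k * m powr 1"
        using km p by (intro mult_left_mono powr_mono) auto
      finally show ?thesis using km by simp
    qed
    from this[OF K moment_const_ge]
    show "(?K powr p * moment_const) powr (1 / p) \<le> ?K * moment_const" .
  qed
  also have "?K * moment_const = 2 * tail_const * moment_const * real n * (ln (real n) + p)"
    by (simp add: A_def L_def)
  finally show ?thesis .
qed

theorem theorem1p4:
  shows "(\<exists>C>0. \<forall>n\<ge>1. \<forall>\<mu>. log_concave_prob n \<mu> \<longrightarrow>
            (\<forall>p\<ge>1. Lp_norm p \<mu> (cramer n \<mu>) \<le> ennreal (C * real n * (ln (real n) + p)))) \<and>
         (\<exists>C>0. \<forall>n\<ge>1. \<forall>\<mu>. log_concave_prob n \<mu> \<longrightarrow>
            (\<forall>u\<ge>0. measure \<mu> {x \<in> space \<mu>. cramer n \<mu> x > ereal (C * real n * (ln (real n) + u))}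
                      \<le> exp (- u)))"
proof (intro conjI)
  have "2 * tail_const * moment_const > 0"
    using tail_const_ge(3) moment_const_ge by simp
  then show "\<exists>C>0. \<forall>n\<ge>1. \<forall>\<mu>. log_concave_prob n \<mu> \<longrightarrow>
      (\<forall>p\<ge>1. Lp_norm p \<mu> (cramer n \<mu>) \<le> ennreal (C * real n * (ln (real n) + p)))"
    using cramer_Lp_norm by blast
  show "\<exists>C>0. \<forall>n\<ge>1. \<forall>\<mu>. log_concave_prob n \<mu> \<longrightarrow>
      (\<forall>u\<ge>0. measure \<mu> {x \<in> space \<mu>. cramer n \<mu> x > ereal (C * real n * (ln (real n) + u))}
                \<le> exp (- u))"
    using cramer_tail tail_const_ge(3) by blast
qed

end
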